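(* Consider the multi-agent system described in the context, whose communication digraph $\mathcal{G}$ contains a spanning tree and whose gain function $a$ satisfies the stated assumptions with some $\gamma\in(0.5,1)$. Then $\tilde{\varepsilon}(t)$ converges to zero in the $p$-th moment, i.e. $\lim_{t\to\infty}\mathbb{E}\|\tilde{\varepsilon}(t)\|^p=0$ for every $p\ge 2$; that is, $\lim_{t\to\infty}\mathbb{E}(x_j(t)-x_i(t))^p=0$ for all agents $i,j$ and all $p\ge 2$.
   Context: Graph: $N$ agents indexed by $\mathcal{V}=\{1,\dots,N\}$; a digraph $\mathcal{G}=(\mathcal{V},\mathcal{E})$ where $(j,i)\in\mathcal{E}$ means agent $i$ receives information from agent $j$. Weighted adjacency matrix $\mathcal{A}=[a_{ij}]$ with $a_{ii}=0$, $a_{ij}>0$ if $(j,i)\in\mathcal{E}$, $a_{ij}=0$ otherwise; in-neighbor set $\mathcal{N}_i=\{j\ne i:(j,i)\in\mathcal{E}\}$; Laplacian $\mathcal{L}=[l_{ij}]$ with $l_{ii}=\sum_{j\ne i}a_{ij}$, $l_{ij}=-a_{ij}$ ($i\neq j$). Since $\mathcal{G}$ contains a spanning tree, $0$ is a simple eigenvalue of $\mathcal{L}$ with right eigenvector $\mathbf{1}_N$ and a left eigenvector $r$ with $r^T\mathbf{1}_N=1$, and all other eigenvalues have positive real part. Gain: $a:[0,\infty)\to[0,\infty)$ is decreasing, bounded and piecewise continuous, and $\lim_{t\to\infty}t^{\gamma}a(t)$ exists and is positive, where $\gamma\in(0.5,1)$. Agents and protocol: agent $i$ has scalar state $x_i(t)\in\mathbb{R}$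 with $\dot x_i(t)=u_i(t)$. Agent $i$ has triggering instants $0=t_{0,i}<t_{1,i}<\cdots$, with $\tilde x_i(t)=x_i(t_{k,i})$ for $t\in[t_{k,i},t_{k+1,i})$, error $e_i(t)=\tilde x_i(t)-x_i(t)$, and $t_{k+1,i}=\inf\{t>t_{k,i}: e_i(t)^2\ge a(t)\}$. Agent $i$ receives from $j\in\mathcal{N}_i$ the signal $\tilde y_{ji}(t)=\tilde x_j(t)+\sigma_{ji}\eta_{ji}(t)$, where $\eta_{ji}$ ($i\in\mathcal{V}$, $j\in\mathcal{N}_i$) are mutually independent standard white noises independent of the initial states and $\sigma_{ji}>0$. The control is $u_i(t)=a(t)\sum_{j\in\mathcal{N}_i}a_{ij}(\tilde y_{ji}(t)-\tilde x_i(t))$. In Itô form, $dx_i(t)=-a(t)\sum_{j=1}^N l_{ij}(x_j(t)+e_j(t))\,dt+a(t)\sum_{j\in\mathcal{N}_i}a_{ij}\sigma_{ji}\,dw_{ji}(t)$, with $w_{ji}$ mutually independent standard one-dimensional Brownian motions. Disagreement: with $x=[x_1,\dots,x_N]^T$ and $J=\mathbf{1}_N r^T$, let $\delta(t)=(I_N-J)x(t)$. Let $T=[\mathbf{1}_N\ Y]$ be invertible with $T^{-1}=[r\ W^T]^T$, $Y\in\mathbb{C}^{N\times(N-1)}$, $W\in\mathbb{C}^{(N-1)\times N}$, such that $T^{-1}\mathcal{L}T=\mathrm{diag}(0,\tilde{\mathcal{L}})$ is the Jordan canonical form of $\mathcal{L}$. Define $\tilde{\varepsilon}(t)=W\delta(t)\in\mathbb{C}^{N-1}$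 (the last $N-1$ components of $T^{-1}\delta(t)$).
   Formalization: The formal theorem also assumes that each initial state x_i(0) has a finite p-th moment; without it (e.g. one Cauchy-distributed initial state, the others 0) the p-th moment of the disagreement is infinite at every time t and the claim fails. *)

theory Defs
  imports "HOL-Probability.Probability"
begin

text \<open>Agents are indexed by 0..N-1 (the paper uses 1..N).\<close>

definition laplacian :: "nat \<Rightarrow> (nat \<Rightarrow> nat \<Rightarrow> real) \<Rightarrow> nat \<Rightarrow> nat \<Rightarrow> real" where
  "laplacian N A i j = (if i = j then (\<Sum>k\<in>{..<N} - {i}. A i k) else - A i j)"

text \<open>Edge (j,i): agent i receives from agent j.\<close>
definition edges :: "nat \<Rightarrow> (nat \<Rightarrow> nat \<Rightarrow> real) \<Rightarrow> (nat \<times> nat) set" where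
  "edges N A = {(j, i). j < N \<and> i < N \<and> j \<noteq> i \<and> A i j > 0}"

definition has_spanning_tree :: "nat \<Rightarrow> (nat \<Rightarrow> nat \<Rightarrow> real) \<Rightarrow> bool" where
  "has_spanning_tree N A \<longleftrightarrow> (\<exists>k<N. \<forall>i<N. (k, i) \<in> (edges N A)\<^sup>*)"

definition piecewise_continuous_nonneg :: "(real \<Rightarrow> real) \<Rightarrow> bool" where
  "piecewise_continuous_nonneg f \<longleftrightarrow>
     (\<forall>T\<ge>0. \<exists>S. finite S \<and> (\<forall>t\<in>{0..T} - S. continuous (at t within {0..}) f))"

text \<open>Standard one-dimensional Brownian motion (paths continuous and starting at 0 almost surely).\<close>
definition std_brownian :: "'a measure \<Rightarrow> (real \<Rightarrow> 'a \<Rightarrow> real) \<Rightarrow> bool" where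
  "std_brownian M B \<longleftrightarrow>
     (\<forall>t\<ge>0. B t \<in> borel_measurable M) \<and>
     (AE \<omega> in M. B 0 \<omega> = 0 \<and> continuous_on {0..} (\<lambda>t. B t \<omega>)) \<and>
     (\<forall>s t. 0 \<le> s \<and> s < t \<longrightarrow>
        distributed M lborel (\<lambda>\<omega>. B t \<omega> - B s \<omega>) (normal_density 0 (sqrt (t - s)))) \<and>
     (\<forall>(n::nat) ts. strict_mono ts \<and> 0 \<le> ts 0 \<longrightarrow>
        prob_space.indep_vars M (\<lambda>_. borel) (\<lambda>k \<omega>. B (ts (Suc k)) \<omega> - B (ts k) \<omega>) {..<n})"

text \<open>Riemann--Stieltjes integral of f against g on [a,b] has value I
  (limit of Riemann--Stieltjes sums as the mesh tends to 0).\<close>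
definition has_rs_integral :: "(real \<Rightarrow> real) \<Rightarrow> (real \<Rightarrow> real) \<Rightarrow> real \<Rightarrow> real \<Rightarrow> real \<Rightarrow> bool" where
  "has_rs_integral f g a b I \<longleftrightarrow>
     (\<forall>\<epsilon>>0. \<exists>\<delta>>0. \<forall>(n::nat) (p::nat \<Rightarrow> real) (\<xi>::nat \<Rightarrow> real).
        p 0 = a \<and> p n = b \<and>
        (\<forall>k<n. p k < p (Suc k) \<and> p (Suc k) - p k < \<delta> \<and> p k \<le> \<xi> k \<and> \<xi> k \<le> p (Suc k))
        \<longrightarrow> \<bar>(\<Sum>k<n. f (\<xi> k) * (g (p (Suc k)) - g (p k))) - I\<bar> < \<epsilon>)"

text \<open>Jordan matrix of size n: zero except diagonal and superdiagonal; superdiagonal entries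
  are 0 or 1, and 1 only between equal diagonal entries.\<close>
definition jordan_matrix :: "nat \<Rightarrow> (nat \<Rightarrow> nat \<Rightarrow> complex) \<Rightarrow> bool" where
  "jordan_matrix n J \<longleftrightarrow>
     (\<forall>i<n. \<forall>j<n. (j \<noteq> i \<and> j \<noteq> Suc i \<longrightarrow> J i j = 0) \<and>
                 (j = Suc i \<longrightarrow> J i j = 0 \<or> (J i j = 1 \<and> J i i = J j j)))"

text \<open>Event-triggered protocol + Ito SDE, pathwise, for one sample path \<omega>.
  x i t \<omega>: state; xt i t \<omega>: last broadcast state \<tilde>x_i(t); tk i k \<omega>: k-th triggering instant
  of agent i (extended real, \<infinity> if no further triggering); w j i: Brownian motion of link (j,i).\<close>
definition protocol_path ::
  "nat \<Rightarrow> (nat \<Rightarrow> nat \<Rightarrow> real) \<Rightarrow> (nat \<Rightarrow> nat \<Rightarrow> real) \<Rightarrow> (real \<Rightarrow> real) \<Rightarrow>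
   (nat \<Rightarrow> nat \<Rightarrow> real \<Rightarrow> 'a \<Rightarrow> real) \<Rightarrow>
   (nat \<Rightarrow> real \<Rightarrow> 'a \<Rightarrow> real) \<Rightarrow> (nat \<Rightarrow> real \<Rightarrow> 'a \<Rightarrow> real) \<Rightarrow>
   (nat \<Rightarrow> nat \<Rightarrow> 'a \<Rightarrow> ereal) \<Rightarrow> 'a \<Rightarrow> bool" where
  "protocol_path N A \<sigma> a w x xt tk \<omega> \<longleftrightarrow>
     (\<forall>i<N.
        tk i 0 \<omega> = 0 \<and>
        (\<forall>k. tk i (Suc k) \<omega> =
              Inf (ereal ` {t. ereal t > tk i k \<omega> \<and>
                     (x i (real_of_ereal (tk i k \<omega>)) \<omega> - x i t \<omega>)\<^sup>2 \<ge> a t})) \<and>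
        (\<forall>t\<ge>0. \<exists>k. tk i k \<omega> \<le> ereal t \<and> ereal t < tk i (Suc k) \<omega>) \<and>
        (\<forall>k t. tk i k \<omega> \<le> ereal t \<and> ereal t < tk i (Suc k) \<omega> \<longrightarrow>
               xt i t \<omega> = x i (real_of_ereal (tk i k \<omega>)) \<omega>) \<and>
        (\<forall>t\<ge>0.
           (\<lambda>s. a s * (\<Sum>j<N. laplacian N A i j * xt j s \<omega>)) integrable_on {0..t} \<and>
           (\<forall>j. (j, i) \<in> edges N A \<longrightarrow>
                 has_rs_integral a (\<lambda>s. w j i s \<omega>) 0 t
                   (THE I. has_rs_integral a (\<lambda>s. w j i s \<omega>) 0 t I)) \<and>
           x i t \<omega> = x i 0 \<omega>
             - integral {0..t} (\<lambda>s. a s * (\<Sum>j<N. laplacian N A i j * xt j s \<omega>))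
             + (\<Sum>j\<in>{j. (j, i) \<in> edges N A}. A i j * \<sigma> j i *
                  (THE I. has_rs_integral a (\<lambda>s. w j i s \<omega>) 0 t I))))"

text \<open>Independence of the link Brownian motions (as path-valued random variables) and the
  initial state vector.\<close>
definition noise_and_init_indep ::
  "'a measure \<Rightarrow> nat \<Rightarrow> (nat \<Rightarrow> nat \<Rightarrow> real) \<Rightarrow> (nat \<Rightarrow> nat \<Rightarrow> real \<Rightarrow> 'a \<Rightarrow> real) \<Rightarrow>
   (nat \<Rightarrow> real \<Rightarrow> 'a \<Rightarrow> real) \<Rightarrow> bool" where
  "noise_and_init_indep M N A w x \<longleftrightarrow>
     prob_space.indep_vars M (\<lambda>_. Pi\<^sub>M UNIV (\<lambda>_::nat. Pi\<^sub>M UNIV (\<lambda>_::real. borel)))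
       (\<lambda>idx \<omega>. case idx of Inl (j, i) \<Rightarrow> (\<lambda>_ t. w j i t \<omega>) | Inr () \<Rightarrow> (\<lambda>k _. x k 0 \<omega>))
       (Inl ` edges N A \<union> {Inr ()})"

end

theory Submission
  imports Defs "HOL-Real_Asymp.Real_Asymp"
begin

text \<open>Since \<open>\<gamma> > 1/2\<close>, the gain is square integrable, so the increments on \<open>[s, t]\<close> of the noise
  integrals \<open>\<integral> a dw\<close> are Gaussian with a variance that tends to 0 as \<open>s\<close> grows, uniformly in \<open>t\<close>; since
  \<open>\<gamma> < 1\<close>, \<open>S t = \<integral>\<^sub>0\<^sup>t a\<close> diverges. In Jordan coordinates \<open>z\<close> with eigenvalue \<open>\<rho>\<close>, \<open>Re \<rho> > 0\<close>, the equation
  reads \<open>dz = - a (\<rho> z + O(sqrt a) + O(\<bar>z'\<bar>)) dt + dZ\<close>, where \<open>Z\<close> is the noise integral, \<open>z'\<close> the next coordinate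
  of the same Jordan block and \<open>sqrt a\<close> bounds the triggering error. The product rule for
  \<open>exp (\<rho> S) (z - Z + Z t)\<close> gives, path by path and without Ito calculus,
  \<open>\<bar>z t\<bar> \<le> exp (- Re \<rho> S t) (\<bar>z 0\<bar> + \<bar>Z t\<bar>) + \<integral> a s exp (- Re \<rho> (S t - S s)) (\<bar>\<rho>\<bar> \<bar>Z t - Z s\<bar> + O(sqrt (a s)) + O(\<bar>z' s\<bar>)) ds\<close>.
  The kernel has mass at most \<open>1 / Re \<rho>\<close> and forgets every bounded time interval, so Jensen's inequality and
  Tonelli's theorem turn this into decay of the \<open>p\<close>-th moments, by induction along the Jordan block.\<close>

subsection \<open>Moments\<close>

text \<open>The state inherits the roughness of the noise integral \<open>Z\<close>, but
  \<open>z - Z\<close> is an indefinite integral and can be differentiated. Adding the constant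
  \<open>Z t\<close> makes the end value \<open>z t\<close> itself and leaves only increments
  \<open>Z t - Z s\<close> in the integrand; their moments are small for late \<open>s\<close>,
  whereas those of \<open>Z s\<close> would merely stay bounded. The triggering error enters through
  a deterministic bound, so the broadcast states are never integrated over the sample space.
  Tonelli's theorem needs joint measurability in time and sample, while the hypotheses give
  measurability at each fixed time. No continuity in time of the noise integrals is at hand, so they
  are realised as limits of Riemann-Stieltjes sums of continuous Brownian paths, and the states are
  recovered by adding a continuous process to them. Moments stay in \<open>ennreal\<close>, so that
  finiteness is proved along with convergence instead of being a side condition.\<close>

lemma powr_sum_le:
  fixes u :: "'i \<Rightarrow> real"
  assumes "finite I" and u: "\<And>i. i \<in> I \<Longrightarrow> 0 \<le> u i" and "0 \<le> p"
  shows "(\<Sum>i\<in>I. u i) powr p \<le> real (card I) powr p * (\<Sum>i\<in>I. u i powr p)"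
proof (cases "I = {}")
  case False
  define m where "m = Max (u ` I)"
  have "m \<in> u ` I"
    unfolding m_def using assms(1) False by (intro Max_in) auto
  then obtain k where k: "k \<in> I" "m = u k" by auto
  have le: "u i \<le> m" if "i \<in> I" for i
    unfolding m_def using assms(1) that by auto
  have "(\<Sum>i\<in>I. u i) \<le> real (card I) * m"
    using sum_bounded_above[of I u m] le by simp
  then have "(\<Sum>i\<in>I. u i) powr p \<le> (real (card I) * m) powr p"
    using u \<open>0 \<le> p\<close> by (intro powr_mono2) (auto intro: sum_nonneg)
  also have "\<dots> = real (card I) powr p * u k powr p"
    using u k by (simp add: powr_mult)
  also have "\<dots> \<le> real (card I) powr p * (\<Sum>i\<in>I. u i powr p)"
    using k assms(1) by (intro mult_left_mono member_le_sum) auto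
  finally show ?thesis .
qed auto

text \<open>Convexity of \<open>f powr p\<close>: its graph lies above the tangent at
  \<open>m\<close>. This is Young's inequality with weights \<open>1/p\<close> and
  \<open>1 - 1/p\<close>.\<close>

lemma powr_above_tangent:
  fixes p m f :: real
  assumes "1 \<le> p" "0 < m" "0 \<le> f"
  shows "p * m powr (p - 1) * f \<le> f powr p + (p - 1) * m powr p"
proof (cases "p = 1 \<or> f = 0")
  case True
  then show ?thesis using assms by auto
next
  case False
  then have "(f powr p) powr (1/p) * (m powr p) powr (1 - 1/p) \<le> 1/p * f powr p + (1 - 1/p) * m powr p"
    using assms by (intro Youngs_inequality_0) (auto simp: field_simps)
  also have "(f powr p) powr (1/p) * (m powr p) powr (1 - 1/p) = f * m powr (p - 1)"
    using assms False by (simp add: powr_powr right_diff_distrib)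
  finally have "p * (f * m powr (p - 1)) \<le> p * (1/p * f powr p + (1 - 1/p) * m powr p)"
    using assms by (intro mult_left_mono) auto
  also have "\<dots> = f powr p + (p - 1) * m powr p"
    using assms by (simp add: field_simps)
  finally show ?thesis by (simp add: ac_simps)
qed

text \<open>Jensen's inequality for a weight of mass at most \<open>K\<close> instead of 1, obtained
  by integrating the tangent bound. The constant term on its upper side is nonnegative, so replacing
  the true mass by \<open>K\<close> only enlarges it.\<close>

lemma nn_integral_jensen_powr:
  fixes \<kappa> :: "'b \<Rightarrow> ennreal" and f :: "'b \<Rightarrow> real"
  assumes [measurable]: "\<kappa> \<in> borel_measurable L" "f \<in> borel_measurable L"
    and f: "\<And>s. 0 \<le> f s" and p: "1 \<le> p" and K: "0 < K" and u: "0 \<le> u"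
    and mass: "(\<integral>\<^sup>+s. \<kappa> s \<partial>L) \<le> ennreal K"
    and le: "ennreal u \<le> (\<integral>\<^sup>+s. \<kappa> s * ennreal (f s) \<partial>L)"
  shows "ennreal (u powr p) \<le> ennreal (K powr (p - 1)) * (\<integral>\<^sup>+s. \<kappa> s * ennreal (f s powr p) \<partial>L)"
proof (cases "u = 0 \<or> (\<integral>\<^sup>+s. \<kappa> s * ennreal (f s powr p) \<partial>L) = \<top>")
  case True
  then show ?thesis using K by (auto simp: ennreal_mult_top)
next
  case False
  then obtain R where R: "(\<integral>\<^sup>+s. \<kappa> s * ennreal (f s powr p) \<partial>L) = ennreal R" "0 \<le> R"
    by (metis ennreal_cases)
  \<comment> \<open>The tangent point is the mean that \<open>u\<close> has under mass
    \<open>K\<close>. With the slope \<open>c\<close> there,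
    \<open>c * u = p * m powr p * K\<close>, and the constant term leaves exactly
    \<open>m powr p * K\<close>.\<close>
  define m where "m = u / K"
  have m: "0 < m" using False u K by (auto simp: m_def)
  define c where "c = p * m powr (p - 1)"
  have "c > 0" using p m by (auto simp: c_def)
  have "ennreal (c * u) = ennreal c * ennreal u"
    using \<open>c > 0\<close> u by (simp add: ennreal_mult)
  also have "\<dots> \<le> ennreal c * (\<integral>\<^sup>+s. \<kappa> s * ennreal (f s) \<partial>L)"
    using le by (rule mult_left_mono) simp
  also have "\<dots> = (\<integral>\<^sup>+s. \<kappa> s * ennreal (c * f s) \<partial>L)"
    using \<open>c > 0\<close> f by (subst nn_integral_cmult[symmetric]) (auto simp: ennreal_mult ac_simps)
  also have "\<dots> \<le> (\<integral>\<^sup>+s. \<kappa> s * ennreal (f s powr p) + ennreal ((p - 1) * m powr p) * \<kappa> s \<partial>L)"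
  proof (rule nn_integral_mono)
    fix s
    have "\<kappa> s * ennreal (c * f s) \<le> \<kappa> s * ennreal (f s powr p + (p - 1) * m powr p)"
      unfolding c_def using powr_above_tangent[OF p m f] by (intro mult_left_mono ennreal_leI) auto
    also have "\<dots> = \<kappa> s * ennreal (f s powr p) + ennreal ((p - 1) * m powr p) * \<kappa> s"
      using p by (subst ennreal_plus) (auto simp: distrib_left ac_simps)
    finally show "\<kappa> s * ennreal (c * f s) \<le> \<kappa> s * ennreal (f s powr p) + ennreal ((p - 1) * m powr p) * \<kappa> s" .
  qed
  also have "\<dots> = ennreal R + ennreal ((p - 1) * m powr p) * (\<integral>\<^sup>+s. \<kappa> s \<partial>L)"
    by (subst nn_integral_add) (auto simp: nn_integral_cmult R)
  also have "\<dots> \<le> ennreal R + ennreal ((p - 1) * m powr p) * ennreal K"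
    using mass by (intro add_left_mono mult_left_mono) auto
  also have "\<dots> = ennreal (R + (p - 1) * m powr p * K)"
    using p K R by (simp add: ennreal_mult ennreal_plus)
  finally have "c * u \<le> R + (p - 1) * m powr p * K"
    using p K R by (subst (asm) ennreal_le_iff) auto
  moreover have "c * u = p * m powr p * K"
    using m K u False by (simp add: c_def m_def powr_diff)
  ultimately have "m powr p * K \<le> R"
    by (simp add: algebra_simps)
  moreover have "u powr p = K powr (p - 1) * (m powr p * K)"
    using K u by (simp add: m_def powr_divide powr_diff)
  ultimately have "u powr p \<le> K powr (p - 1) * R"
    by (simp add: mult_left_mono)
  then show ?thesis
    using R by (simp add: ennreal_mult[symmetric] ennreal_leI)
qed

text \<open>Convergence alone would not pass through the kernel: on an initial interval, where
  \<open>h\<close> is not yet small, the averaging argument needs a finite bound.\<close>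

definition moments_vanish :: "(real \<Rightarrow> ennreal) \<Rightarrow> bool" where
  "moments_vanish h \<longleftrightarrow> (\<exists>B. \<forall>t\<ge>0. h t \<le> ennreal B) \<and> (h \<longlongrightarrow> 0) at_top"

lemma moments_vanish_mono:
  assumes "moments_vanish h" and le: "\<And>t. 0 \<le> t \<Longrightarrow> g t \<le> h t"
  shows "moments_vanish g"
  unfolding moments_vanish_def
proof
  show "\<exists>B. \<forall>t\<ge>0. g t \<le> ennreal B"
    using assms unfolding moments_vanish_def by (meson order_trans)
  show "(g \<longlongrightarrow> 0) at_top"
  proof (rule tendsto_sandwich[of "\<lambda>_. 0" _ _ h])
    show "\<forall>\<^sub>F t in at_top. g t \<le> h t"
      using eventually_mono[OF eventually_ge_at_top[of "0::real"] le] .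
  qed (use assms in \<open>auto simp: moments_vanish_def\<close>)
qed

lemma moments_vanish_add:
  assumes "moments_vanish g" "moments_vanish h"
  shows "moments_vanish (\<lambda>t. g t + h t)"
  unfolding moments_vanish_def
proof
  obtain A B where "\<forall>t\<ge>0. g t \<le> ennreal A" "\<forall>t\<ge>0. h t \<le> ennreal B"
    using assms unfolding moments_vanish_def by blast
  then have "\<forall>t\<ge>0. g t \<le> ennreal \<bar>A\<bar>" "\<forall>t\<ge>0. h t \<le> ennreal \<bar>B\<bar>"
    by (meson abs_ge_self ennreal_leI order_trans)+
  then have "\<forall>t\<ge>0. g t + h t \<le> ennreal (\<bar>A\<bar> + \<bar>B\<bar>)"
    by (simp add: add_mono ennreal_plus)
  then show "\<exists>B. \<forall>t\<ge>0. g t + h t \<le> ennreal B" ..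
  show "((\<lambda>t. g t + h t) \<longlongrightarrow> 0) at_top"
    using tendsto_add[of g 0 at_top h 0] assms by (simp add: moments_vanish_def)
qed

lemma moments_vanish_cmult:
  assumes "moments_vanish h"
  shows "moments_vanish (\<lambda>t. ennreal c * h t)"
  unfolding moments_vanish_def
proof
  obtain B where "\<forall>t\<ge>0. h t \<le> ennreal B"
    using assms unfolding moments_vanish_def by blast
  then have "\<forall>t\<ge>0. ennreal c * h t \<le> ennreal (max 0 c * max 0 B)"
    by (auto simp: ennreal_mult ennreal_max_0 intro!: mult_left_mono)
  then show "\<exists>B. \<forall>t\<ge>0. ennreal c * h t \<le> ennreal B" ..
  show "((\<lambda>t. ennreal c * h t) \<longlongrightarrow> 0) at_top"
    using assms tendsto_mult_ennreal[of "\<lambda>_. ennreal c" "ennreal c" at_top h 0]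
    by (simp add: moments_vanish_def)
qed

lemma moments_vanish_zero: "moments_vanish (\<lambda>_. 0)"
  by (auto simp: moments_vanish_def)

lemma moments_vanish_sum:
  assumes "\<And>i. i \<in> I \<Longrightarrow> moments_vanish (h i)"
  shows "moments_vanish (\<lambda>t. \<Sum>i\<in>I. h i t)"
  using assms by (induction I rule: infinite_finite_induct)
    (auto intro: moments_vanish_zero moments_vanish_add)

lemma moments_vanish_real:
  assumes "(f \<longlongrightarrow> 0) at_top" "\<And>t. 0 \<le> t \<Longrightarrow> f t \<le> B"
  shows "moments_vanish (\<lambda>t. ennreal (f t))"
  unfolding moments_vanish_def
  using assms by (auto intro!: exI[of _ B] ennreal_leI tendsto_ennrealI[of f 0, simplified])

section \<open>Moments of order p as nonnegative integrals\<close>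

definition pmoment :: "'a measure \<Rightarrow> real \<Rightarrow> ('a \<Rightarrow> real) \<Rightarrow> ennreal" where
  "pmoment M p f = (\<integral>\<^sup>+\<omega>. ennreal (f \<omega> powr p) \<partial>M)"

lemma pmoment_mono:
  assumes "AE \<omega> in M. 0 \<le> f \<omega> \<and> f \<omega> \<le> g \<omega>" "0 \<le> p"
  shows "pmoment M p f \<le> pmoment M p g"
  unfolding pmoment_def using assms(1)
  by (intro nn_integral_mono_AE, eventually_elim) (auto intro!: ennreal_leI powr_mono2 assms(2))

lemma pmoment_cmult:
  assumes "f \<in> borel_measurable M" "\<And>\<omega>. 0 \<le> f \<omega>" "0 \<le> c"
  shows "pmoment M p (\<lambda>\<omega>. c * f \<omega>) = ennreal (c powr p) * pmoment M p f"
  unfolding pmoment_def using assms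
  by (subst nn_integral_cmult[symmetric]) (auto simp: powr_mult ennreal_mult)

lemma pmoment_sum_le:
  assumes "finite I" "\<And>i. i \<in> I \<Longrightarrow> f i \<in> borel_measurable M" "\<And>i \<omega>. i \<in> I \<Longrightarrow> 0 \<le> f i \<omega>" "0 \<le> p"
  shows "pmoment M p (\<lambda>\<omega>. \<Sum>i\<in>I. f i \<omega>) \<le> ennreal (real (card I) powr p) * (\<Sum>i\<in>I. pmoment M p (f i))"
proof -
  have "pmoment M p (\<lambda>\<omega>. \<Sum>i\<in>I. f i \<omega>)
      \<le> (\<integral>\<^sup>+\<omega>. ennreal (real (card I) powr p) * (\<Sum>i\<in>I. ennreal (f i \<omega> powr p)) \<partial>M)"
    unfolding pmoment_def
  proof (rule nn_integral_mono)
    fix \<omega>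
    have "ennreal ((\<Sum>i\<in>I. f i \<omega>) powr p) \<le> ennreal (real (card I) powr p * (\<Sum>i\<in>I. f i \<omega> powr p))"
      using assms by (intro ennreal_leI powr_sum_le) auto
    also have "\<dots> = ennreal (real (card I) powr p) * (\<Sum>i\<in>I. ennreal (f i \<omega> powr p))"
      by (subst sum_ennreal) (auto simp: ennreal_mult sum_nonneg)
    finally show "ennreal ((\<Sum>i\<in>I. f i \<omega>) powr p)
        \<le> ennreal (real (card I) powr p) * (\<Sum>i\<in>I. ennreal (f i \<omega> powr p))" .
  qed
  also have "\<dots> = ennreal (real (card I) powr p) * (\<Sum>i\<in>I. pmoment M p (f i))"
    unfolding pmoment_def using assms by (subst nn_integral_sum[symmetric], simp, subst nn_integral_cmult[symmetric]) auto
  finally show ?thesis .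
qed

lemma pmoment_add_le:
  assumes [measurable]: "f \<in> borel_measurable M" "g \<in> borel_measurable M"
    and "\<And>\<omega>. 0 \<le> f \<omega>" "\<And>\<omega>. 0 \<le> g \<omega>" "0 \<le> p"
  shows "pmoment M p (\<lambda>\<omega>. f \<omega> + g \<omega>) \<le> ennreal (2 powr p) * (pmoment M p f + pmoment M p g)"
  using pmoment_sum_le[of "UNIV :: bool set" "\<lambda>b. if b then f else g" M p] assms
  by (simp add: UNIV_bool add.commute)

text \<open>The coefficients are complex because the Jordan basis is, while states and noise are
  real.\<close>

lemma pmoment_lincomb_le:
  fixes c :: "'i \<Rightarrow> complex" and f :: "'i \<Rightarrow> 'a \<Rightarrow> real"
  assumes "finite I" "\<And>i. i \<in> I \<Longrightarrow> f i \<in> borel_measurable M" "0 \<le> p"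
  shows "pmoment M p (\<lambda>\<omega>. cmod (\<Sum>i\<in>I. c i * of_real (f i \<omega>)))
    \<le> ennreal (real (card I) powr p) * (\<Sum>i\<in>I. ennreal (cmod (c i) powr p) * pmoment M p (\<lambda>\<omega>. \<bar>f i \<omega>\<bar>))"
proof -
  have "pmoment M p (\<lambda>\<omega>. cmod (\<Sum>i\<in>I. c i * of_real (f i \<omega>)))
      \<le> pmoment M p (\<lambda>\<omega>. \<Sum>i\<in>I. cmod (c i) * \<bar>f i \<omega>\<bar>)"
    using assms by (intro pmoment_mono) (auto intro!: sum_norm_le simp: norm_mult)
  also have "\<dots> \<le> ennreal (real (card I) powr p) * (\<Sum>i\<in>I. pmoment M p (\<lambda>\<omega>. cmod (c i) * \<bar>f i \<omega>\<bar>))"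
    using assms by (intro pmoment_sum_le) auto
  also have "(\<Sum>i\<in>I. pmoment M p (\<lambda>\<omega>. cmod (c i) * \<bar>f i \<omega>\<bar>))
      = (\<Sum>i\<in>I. ennreal (cmod (c i) powr p) * pmoment M p (\<lambda>\<omega>. \<bar>f i \<omega>\<bar>))"
    using assms by (intro sum.cong pmoment_cmult) auto
  finally show ?thesis .
qed

subsection \<open>Riemann--Stieltjes sums against Brownian paths\<close>

text \<open>The condition on partitions and tags inside \<open>has_rs_integral\<close>, isolated so
  that a mesh obtained from one integral can be applied to constructed partitions.\<close>

definition fine_partition :: "real \<Rightarrow> real \<Rightarrow> real \<Rightarrow> nat \<Rightarrow> (nat \<Rightarrow> real) \<Rightarrow> (nat \<Rightarrow> real) \<Rightarrow> bool" where
  "fine_partition a b \<delta> n p \<xi> \<longleftrightarrow> p 0 = a \<and> p n = b \<and>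
     (\<forall>k<n. p k < p (Suc k) \<and> p (Suc k) - p k < \<delta> \<and> p k \<le> \<xi> k \<and> \<xi> k \<le> p (Suc k))"

lemma has_rs_integral_fine:
  assumes "has_rs_integral f g a b I" "0 < \<epsilon>"
  shows "\<exists>\<delta>>0. \<forall>n p \<xi>. fine_partition a b \<delta> n p \<xi> \<longrightarrow>
      \<bar>(\<Sum>k<n. f (\<xi> k) * (g (p (Suc k)) - g (p k))) - I\<bar> < \<epsilon>"
  using assms unfolding has_rs_integral_def fine_partition_def by (elim allE impE)

definition grid :: "real \<Rightarrow> real \<Rightarrow> nat \<Rightarrow> nat \<Rightarrow> real" where
  "grid s t n k = s + real k * ((t - s) / real n)"

definition rs_sum :: "(real \<Rightarrow> real) \<Rightarrow> (real \<Rightarrow> real) \<Rightarrow> real \<Rightarrow> real \<Rightarrow> nat \<Rightarrow> real" where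
  "rs_sum f g s t n = (\<Sum>k<n. f (grid s t n (Suc k)) * (g (grid s t n (Suc k)) - g (grid s t n k)))"

lemma grid_Suc_diff: "grid s t n (Suc k) - grid s t n k = (t - s) / real n"
  by (simp add: grid_def algebra_simps add_divide_distrib[symmetric])

lemma grid_0[simp]: "grid s t n 0 = s" and grid_end: "0 < n \<Longrightarrow> grid s t n n = t"
  by (auto simp: grid_def)

lemma fine_grid:
  assumes "s < t" "0 < \<delta>"
  shows "\<forall>\<^sub>F n in sequentially. 0 < n \<and> (t - s) / real n < \<delta>"
proof -
  have "(\<lambda>n. (t - s) / real n) \<longlonglongrightarrow> 0"
    by (rule lim_const_over_n)
  then have "\<forall>\<^sub>F n in sequentially. (t - s) / real n < \<delta>"
    using assms(2) by (intro order_tendstoD)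
  then show ?thesis using eventually_gt_at_top[of 0] by eventually_elim auto
qed

text \<open>Partitions are strictly increasing, so a one-point interval admits only
  \<open>n = 0\<close>, with the empty sum.\<close>

lemma has_rs_integral_degenerate: assumes "has_rs_integral f g s s I" shows "I = 0"
proof (rule ccontr)
  assume "I \<noteq> 0"
  then have I: "0 < \<bar>I\<bar>" by simp
  obtain \<delta> where "0 < \<delta>" and \<delta>: "\<forall>n p \<xi>. fine_partition s s \<delta> n p \<xi> \<longrightarrow>
      \<bar>(\<Sum>k<n. f (\<xi> k) * (g (p (Suc k)) - g (p k))) - I\<bar> < \<bar>I\<bar>"
    using has_rs_integral_fine[OF assms I] by (elim exE conjE) (rule that)
  have "fine_partition s s \<delta> 0 (\<lambda>_. s) (\<lambda>_. s)" by (simp add: fine_partition_def)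
  then show False using \<delta>[rule_format, of 0 "\<lambda>_. s" "\<lambda>_. s"] by simp
qed

lemma rs_sum_tendsto:
  assumes I: "has_rs_integral f g s t I" and "s \<le> t"
  shows "rs_sum f g s t \<longlonglongrightarrow> I"
proof (cases "s = t")
  \<comment> \<open>A grid with zero step is not a fine partition, but all its increments
    vanish.\<close>
  case True
  then show ?thesis using has_rs_integral_degenerate[of f g s I] I by (simp add: rs_sum_def[abs_def] grid_def)
next
  case False
  with \<open>s \<le> t\<close> have st: "s < t" by simp
  show ?thesis
  proof (rule tendstoI)
    fix \<epsilon> :: real assume \<epsilon>: "0 < \<epsilon>"
    obtain \<delta> where \<delta>: "0 < \<delta>" "\<forall>n p \<xi>. fine_partition s t \<delta> n p \<xi> \<longrightarrow>
      \<bar>(\<Sum>k<n. f (\<xi> k) * (g (p (Suc k)) - g (p k))) - I\<bar> < \<epsilon>"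
      using has_rs_integral_fine[OF I \<epsilon>] by (elim exE conjE) (rule that)
    from fine_grid[OF st \<delta>(1)]
    show "\<forall>\<^sub>F n in sequentially. dist (rs_sum f g s t n) I < \<epsilon>"
    proof eventually_elim
      case (elim n)
      then have "0 < (t - s) / real n" using st by simp
      then have "grid s t n k < grid s t n (Suc k)" for k
        using grid_Suc_diff[of s t n k] by linarith
      then show ?case
        unfolding dist_real_def rs_sum_def
        using elim by (intro \<delta>(2)[rule_format]) (auto simp: fine_partition_def grid_end grid_Suc_diff less_imp_le)
    qed
  qed
qed

text \<open>A fixed fine partition of \<open>[a, s]\<close> is prefixed to an arbitrary one of
  \<open>[s, t]\<close>; the sum over the prefix is near \<open>I1\<close> and the sum over the
  whole near \<open>I2\<close>, each within half the tolerance.\<close>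

lemma has_rs_integral_diff:
  assumes I1: "has_rs_integral f g a s I1" and I2: "has_rs_integral f g a t I2" and "a \<le> s"
  shows "has_rs_integral f g s t (I2 - I1)"
  unfolding has_rs_integral_def
proof (intro allI impI)
  fix \<epsilon> :: real assume "0 < \<epsilon>"
  then have e: "0 < \<epsilon> / 2" by simp
  obtain \<delta>1 where \<delta>1: "0 < \<delta>1" "\<forall>n p \<xi>. fine_partition a s \<delta>1 n p \<xi> \<longrightarrow>
      \<bar>(\<Sum>k<n. f (\<xi> k) * (g (p (Suc k)) - g (p k))) - I1\<bar> < \<epsilon> / 2"
    using has_rs_integral_fine[OF I1 e] by (elim exE conjE) (rule that)
  obtain \<delta>2 where \<delta>2: "0 < \<delta>2" "\<forall>n p \<xi>. fine_partition a t \<delta>2 n p \<xi> \<longrightarrow>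
      \<bar>(\<Sum>k<n. f (\<xi> k) * (g (p (Suc k)) - g (p k))) - I2\<bar> < \<epsilon> / 2"
    using has_rs_integral_fine[OF I2 e] by (elim exE conjE) (rule that)
  define \<delta> where "\<delta> = min \<delta>1 \<delta>2"
  have "0 < \<delta>" using \<delta>1 \<delta>2 by (simp add: \<delta>_def)
  obtain m q where q: "q 0 = a" "q m = s" "\<And>k. k < m \<Longrightarrow> q k < q (Suc k) \<and> q (Suc k) - q k < \<delta>"
  proof (cases "a = s")
    case True
    then show thesis using that[of "\<lambda>_. a" 0] by simp
  next
    case False
    with \<open>a \<le> s\<close> have "a < s" by simp
    from eventually_happens[OF fine_grid[OF this \<open>0 < \<delta>\<close>]]
    obtain n where n: "0 < n" "(s - a) / real n < \<delta>" by auto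
    with \<open>a < s\<close> have "0 < (s - a) / real n" by simp
    then have "grid a s n k < grid a s n (Suc k)" for k
      using grid_Suc_diff[of a s n k] by linarith
    then show thesis using that[of "grid a s n" n] n by (auto simp: grid_end grid_Suc_diff)
  qed
  show "\<exists>\<delta>>0. \<forall>n p \<xi>. p 0 = s \<and> p n = t \<and>
        (\<forall>k<n. p k < p (Suc k) \<and> p (Suc k) - p k < \<delta> \<and> p k \<le> \<xi> k \<and> \<xi> k \<le> p (Suc k)) \<longrightarrow>
        \<bar>(\<Sum>k<n. f (\<xi> k) * (g (p (Suc k)) - g (p k))) - (I2 - I1)\<bar> < \<epsilon>"
  proof (intro exI[of _ \<delta>] conjI allI impI \<open>0 < \<delta>\<close>, elim conjE)
    fix n p \<xi> assume p: "p 0 = s" "p n = t"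
      "\<forall>k<n. p k < p (Suc k) \<and> p (Suc k) - p k < \<delta> \<and> p k \<le> \<xi> k \<and> \<xi> k \<le> p (Suc k)"
    \<comment> \<open>\<open>P\<close> and \<open>\<Xi>\<close> splice the two partitions at index
      \<open>m\<close>, where \<open>q m = p 0 = s\<close>; in the prefix the left end points serve
      as tags.\<close>
    define P where "P k = (if k < m then q k else p (k - m))" for k
    define \<Xi> where "\<Xi> k = (if k < m then q k else \<xi> (k - m))" for k
    have Plow: "P k = q k" if "k \<le> m" for k
      using that q p by (cases "k = m") (auto simp: P_def)
    have Phigh: "P (m + k) = p k" for k by (simp add: P_def)
    have s1: "\<bar>(\<Sum>k<m. f (q k) * (g (q (Suc k)) - g (q k))) - I1\<bar> < \<epsilon> / 2"
      using q by (intro \<delta>1(2)[rule_format]) (auto simp: fine_partition_def \<delta>_def less_imp_le)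
    have s2: "\<bar>(\<Sum>k<m+n. f (\<Xi> k) * (g (P (Suc k)) - g (P k))) - I2\<bar> < \<epsilon> / 2"
    proof (rule \<delta>2(2)[rule_format], unfold fine_partition_def, intro conjI allI impI)
      show "P 0 = a" using Plow[of 0] q by simp
      show "P (m + n) = t" using Phigh p by simp
      fix k assume k: "k < m + n"
      have "P k < P (Suc k) \<and> P (Suc k) - P k < \<delta>2 \<and> P k \<le> \<Xi> k \<and> \<Xi> k \<le> P (Suc k)"
      proof (cases "k < m")
        case True
        then show ?thesis using q(3)[of k] Plow[of k] Plow[of "Suc k"] by (simp add: \<Xi>_def \<delta>_def)
      next
        case False
        then obtain j where j: "k = m + j" by (metis le_add_diff_inverse not_less)
        then show ?thesis using p(3) k Phigh[of j] Phigh[of "Suc j"] by (simp add: \<Xi>_def \<delta>_def)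
      qed
      then show "P k < P (Suc k)" "P (Suc k) - P k < \<delta>2" "P k \<le> \<Xi> k" "\<Xi> k \<le> P (Suc k)" by blast+
    qed
    have "(\<Sum>k<m+n. f (\<Xi> k) * (g (P (Suc k)) - g (P k)))
        = (\<Sum>k<m. f (\<Xi> k) * (g (P (Suc k)) - g (P k)))
          + (\<Sum>k<n. f (\<Xi> (m + k)) * (g (P (Suc (m + k))) - g (P (m + k))))"
      by (induction n) (simp_all add: algebra_simps)
    also have "(\<Sum>k<m. f (\<Xi> k) * (g (P (Suc k)) - g (P k))) = (\<Sum>k<m. f (q k) * (g (q (Suc k)) - g (q k)))"
      by (intro sum.cong) (auto simp: Plow \<Xi>_def)
    also have "(\<Sum>k<n. f (\<Xi> (m + k)) * (g (P (Suc (m + k))) - g (P (m + k))))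
        = (\<Sum>k<n. f (\<xi> k) * (g (p (Suc k)) - g (p k)))"
      using Phigh by (intro sum.cong refl) (simp add: \<Xi>_def flip: add_Suc_right)
    finally show "\<bar>(\<Sum>k<n. f (\<xi> k) * (g (p (Suc k)) - g (p k))) - (I2 - I1)\<bar> < \<epsilon>"
      using s1 s2 by linarith
  qed
qed

section \<open>Gaussian moments and Gaussian Riemann sums\<close>

definition normal_abs_moment :: "real \<Rightarrow> real" where
  "normal_abs_moment p = (\<integral>z. std_normal_density z * \<bar>z\<bar> powr p \<partial>lborel)"

text \<open>The exponent is real; the integrand is dominated by those of the moments of order 0 and
  of order \<open>m\<close>, the exponent rounded up.\<close>

lemma integrable_normal_abs_moment:
  assumes "0 \<le> p"
  shows "integrable lborel (\<lambda>z. std_normal_density z * \<bar>z\<bar> powr p)"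
proof (rule Bochner_Integration.integrable_bound)
  define m where "m = nat \<lceil>p\<rceil>"
  show "integrable lborel (\<lambda>z. std_normal_density z * \<bar>z\<bar>^0 + std_normal_density z * \<bar>z\<bar>^m)"
    by (intro Bochner_Integration.integrable_add integrable_std_normal_moment_abs)
  have "\<bar>z\<bar> powr p \<le> 1 + \<bar>z\<bar> ^ m" for z :: real
  proof (cases "\<bar>z\<bar> \<le> 1")
    case True
    then have "\<bar>z\<bar> powr p \<le> 1 powr p" using assms by (intro powr_mono2) auto
    then show ?thesis by (simp add: add_increasing2)
  next
    case False
    then have "\<bar>z\<bar> powr p \<le> \<bar>z\<bar> powr (real m)"
      using assms by (intro powr_mono) (auto simp: m_def)
    also have "\<dots> = \<bar>z\<bar> ^ m" using False by (intro powr_realpow) auto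
    finally show ?thesis by simp
  qed
  then have "std_normal_density z * \<bar>z\<bar> powr p \<le> std_normal_density z * (1 + \<bar>z\<bar> ^ m)" for z
    by (intro mult_left_mono) auto
  then show "AE z in lborel. norm (std_normal_density z * \<bar>z\<bar> powr p)
      \<le> norm (std_normal_density z * \<bar>z\<bar>^0 + std_normal_density z * \<bar>z\<bar>^m)"
    by (auto simp: distrib_left)
qed simp

lemma normal_abs_moment_nonneg: "0 \<le> normal_abs_moment p"
  unfolding normal_abs_moment_def by (intro integral_nonneg_AE) auto

lemma (in prob_space) normal_abs_moment:
  assumes X: "distributed M lborel X (normal_density 0 \<sigma>)" and "0 < \<sigma>" "0 \<le> p"
  shows "(\<integral>\<^sup>+\<omega>. ennreal (\<bar>X \<omega>\<bar> powr p) \<partial>M) = ennreal (\<sigma> powr p * normal_abs_moment p)"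
proof -
  have D: "distributed M lborel (\<lambda>\<omega>. (X \<omega> - 0) / \<sigma>) std_normal_density"
    using X normal_standard_normal_convert[of \<sigma> X 0] assms by simp
  have "(\<integral>\<^sup>+\<omega>. ennreal (\<bar>X \<omega>\<bar> powr p) \<partial>M)
      = (\<integral>\<^sup>+\<omega>. ennreal (\<sigma> powr p) * ennreal (\<bar>(X \<omega> - 0) / \<sigma>\<bar> powr p) \<partial>M)"
    using \<open>0 < \<sigma>\<close> by (intro nn_integral_cong) (simp add: ennreal_mult[symmetric] powr_divide)
  also have "\<dots> = ennreal (\<sigma> powr p) * (\<integral>\<^sup>+\<omega>. ennreal (\<bar>(X \<omega> - 0) / \<sigma>\<bar> powr p) \<partial>M)"
    using distributed_measurable[OF X] by (intro nn_integral_cmult) simp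
  also have "(\<integral>\<^sup>+\<omega>. ennreal (\<bar>(X \<omega> - 0) / \<sigma>\<bar> powr p) \<partial>M)
      = (\<integral>\<^sup>+z. ennreal (std_normal_density z) * ennreal (\<bar>z\<bar> powr p) \<partial>lborel)"
    by (rule distributed_nn_integral[OF D, symmetric]) simp
  also have "\<dots> = (\<integral>\<^sup>+z. ennreal (std_normal_density z * \<bar>z\<bar> powr p) \<partial>lborel)"
    by (simp add: ennreal_mult)
  also have "\<dots> = ennreal (normal_abs_moment p)"
    unfolding normal_abs_moment_def
    using integrable_normal_abs_moment[OF \<open>0 \<le> p\<close>] by (intro nn_integral_eq_integral) auto
  finally show ?thesis
    by (simp add: ennreal_mult normal_abs_moment_nonneg)
qed

text \<open>The cells contribute independent centred Gaussians, so the variances add up. Positivity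
  of \<open>f\<close> gives every summand a positive standard deviation, as a normal density
  demands.\<close>

lemma (in prob_space) brownian_rs_sum_normal:
  assumes W: "std_brownian M W" and s: "0 \<le> s" "s < t" and n: "0 < n"
    and f: "\<And>u. 0 \<le> u \<Longrightarrow> 0 < f u"
  shows "distributed M lborel (\<lambda>\<omega>. rs_sum f (\<lambda>u. W u \<omega>) s t n)
    (normal_density 0 (sqrt (\<Sum>k<n. (f (grid s t n (Suc k)))\<^sup>2 * ((t - s) / real n))))"
proof -
  let ?g = "grid s t n"
  have \<Delta>: "0 < (t - s) / real n" using s n by simp
  have step: "?g k < ?g (Suc k)" for k using grid_Suc_diff[of s t n k] \<Delta> by linarith
  \<comment> \<open>\<open>std_brownian\<close> speaks of times that increase along all naturals;
    the grid qualifies because it runs on past \<open>t\<close> for indices above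
    \<open>n\<close>.\<close>
  then have mono: "strict_mono ?g" by (rule strict_mono_Suc_iff[THEN iffD2, rule_format])
  have g0: "0 \<le> ?g k" for k using s by (simp add: grid_def)
  have "indep_vars (\<lambda>_. borel) (\<lambda>k \<omega>. W (?g (Suc k)) \<omega> - W (?g k) \<omega>) {..<n}"
    using W mono s unfolding std_brownian_def by auto
  from indep_vars_compose2[OF this, where Y = "\<lambda>k y. f (?g (Suc k)) * y" and N = "\<lambda>_. borel"]
  have ind: "indep_vars (\<lambda>_. borel) (\<lambda>k \<omega>. f (?g (Suc k)) * (W (?g (Suc k)) \<omega> - W (?g k) \<omega>)) {..<n}"
    by simp
  have D: "distributed M lborel (\<lambda>\<omega>. f (?g (Suc k)) * (W (?g (Suc k)) \<omega> - W (?g k) \<omega>))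
      (normal_density 0 (f (?g (Suc k)) * sqrt ((t - s) / real n)))" for k
  proof -
    have "distributed M lborel (\<lambda>\<omega>. W (?g (Suc k)) \<omega> - W (?g k) \<omega>)
      (normal_density 0 (sqrt (?g (Suc k) - ?g k)))"
      using W g0 step unfolding std_brownian_def by blast
    from normal_density_affine[OF this, of "f (?g (Suc k))" 0]
    show ?thesis using \<Delta> f[OF g0, of "Suc k"] by (simp add: grid_Suc_diff)
  qed
  have "distributed M lborel (\<lambda>\<omega>. \<Sum>k<n. f (?g (Suc k)) * (W (?g (Suc k)) \<omega> - W (?g k) \<omega>))
     (normal_density (\<Sum>k<n. 0) (sqrt (\<Sum>k<n. (f (?g (Suc k)) * sqrt ((t - s) / real n))\<^sup>2)))"
    using n \<Delta> f[OF g0] by (intro sum_indep_normal ind D) (auto simp del: sum.lessThan_Suc)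
  then show ?thesis
    using \<Delta> s by (simp add: rs_sum_def power_mult_distrib)
qed

text \<open>Continuity in time makes the process a pointwise limit of processes frozen at the last
  multiple of \<open>1 / Suc n\<close>; these use countably many times and are jointly measurable.
  Clipping at 0 extends the process to the whole line.\<close>

lemma borel_measurable_caratheodory:
  fixes f :: "real \<Rightarrow> 'a \<Rightarrow> real"
  assumes f: "\<And>t. 0 \<le> t \<Longrightarrow> f t \<in> borel_measurable M"
    and cont: "\<And>\<omega>. \<omega> \<in> space M \<Longrightarrow> continuous_on {0..} (\<lambda>t. f t \<omega>)"
  shows "(\<lambda>(t, \<omega>). f (max 0 t) \<omega>) \<in> borel_measurable (borel \<Otimes>\<^sub>M M)"
proof (rule borel_measurable_LIMSEQ_real)
  define g where "g n t = nat \<lfloor>real (Suc n) * max 0 t\<rfloor>" for n t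
  let ?F = "\<lambda>n (t, \<omega>). f (real (g n t) / real (Suc n)) \<omega>"
  show "?F n \<in> borel_measurable (borel \<Otimes>\<^sub>M M)" for n
  proof -
    have [measurable]: "g n \<in> borel \<rightarrow>\<^sub>M count_space UNIV" unfolding g_def by measurable
    have [measurable]: "f (real i / real (Suc n)) \<in> borel_measurable M" for i by (rule f) auto
    have "(\<lambda>x. f (real (g n (fst x)) / real (Suc n)) (snd x)) \<in> borel_measurable (borel \<Otimes>\<^sub>M M)"
      by (rule measurable_compose_countable[of "\<lambda>i x. f (real i / real (Suc n)) (snd x)" _ _ "\<lambda>x. g n (fst x)"]) measurable
    then show ?thesis by (simp add: case_prod_beta)
  qed
  fix x assume x: "x \<in> space (borel \<Otimes>\<^sub>M M :: (real \<times> 'a) measure)"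
  obtain t \<omega> where x': "x = (t, \<omega>)" "\<omega> \<in> space M" using x by (auto simp: space_pair_measure)
  have "(\<lambda>n. real (g n t) / real (Suc n)) \<longlonglongrightarrow> max 0 t"
  proof (rule tendsto_sandwich)
    have le: "real (Suc n) * max 0 t - 1 \<le> real (g n t) \<and> real (g n t) \<le> real (Suc n) * max 0 t" for n
    proof -
      have "0 \<le> real (Suc n) * max 0 t" by simp
      then show ?thesis unfolding g_def by (simp only: of_nat_nat zero_le_floor) linarith
    qed
    show "\<forall>\<^sub>F n in sequentially. max 0 t - 1 / real (Suc n) \<le> real (g n t) / real (Suc n)"
    proof (rule always_eventually, rule allI)
      fix n
      have "(real (Suc n) * max 0 t - 1) / real (Suc n) \<le> real (g n t) / real (Suc n)"
        using le[of n] by (intro divide_right_mono) auto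
      then show "max 0 t - 1 / real (Suc n) \<le> real (g n t) / real (Suc n)"
        by (simp only: diff_divide_distrib) simp
    qed
    show "\<forall>\<^sub>F n in sequentially. real (g n t) / real (Suc n) \<le> max 0 t"
    proof (rule always_eventually, rule allI)
      fix n
      have "real (g n t) / real (Suc n) \<le> (real (Suc n) * max 0 t) / real (Suc n)"
        using le[of n] by (intro divide_right_mono) auto
      then show "real (g n t) / real (Suc n) \<le> max 0 t" by simp
    qed
    have "(\<lambda>n. max 0 t - 1 / real (Suc n)) \<longlonglongrightarrow> max 0 t - 0"
      by (intro tendsto_intros LIMSEQ_Suc[OF lim_const_over_n])
    then show "(\<lambda>n. max 0 t - 1 / real (Suc n)) \<longlonglongrightarrow> max 0 t" by simp
  qed simp
  then have "(\<lambda>n. f (real (g n t) / real (Suc n)) \<omega>) \<longlonglongrightarrow> f (max 0 t) \<omega>"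
    by (intro continuous_on_tendsto_compose[OF cont[OF x'(2)]]) (auto intro!: always_eventually)
  then show "(\<lambda>n. ?F n x) \<longlonglongrightarrow> (case x of (t, \<omega>) \<Rightarrow> f (max 0 t) \<omega>)"
    by (simp add: x')
qed

subsection \<open>The gain function and its kernel\<close>

lemma integral_has_vector_derivative_interior:
  fixes g :: "real \<Rightarrow> 'b::banach"
  assumes "g integrable_on {0..t}" "0 < s" "s < t" "isCont g s"
  shows "((\<lambda>u. integral {0..u} g) has_vector_derivative g s) (at s)"
proof -
  have "continuous (at s within ({0..t} - {})) g"
    using assms(4) by (rule continuous_at_imp_continuous_at_within)
  then have "((\<lambda>u. integral {0..u} g) has_vector_derivative g s) (at s within ({0..t} - {}))"
    using assms(2,3) by (intro integral_has_vector_derivative_continuous_at[OF assms(1)]) simp_all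
  moreover have "at s within {0..t} = at s"
    using assms(2,3) by (intro at_within_interior) simp
  ultimately show ?thesis by simp
qed

locale gain =
  fixes a :: "real \<Rightarrow> real" and \<gamma> :: real
  assumes nonneg: "\<And>t. 0 \<le> t \<Longrightarrow> 0 \<le> a t"
    and decr: "\<And>s t. 0 \<le> s \<Longrightarrow> s \<le> t \<Longrightarrow> a t \<le> a s"
    and pc: "piecewise_continuous_nonneg a"
    and \<gamma>: "1/2 < \<gamma>" "\<gamma> < 1"
    and rate: "\<exists>c>0. ((\<lambda>t. t powr \<gamma> * a t) \<longlongrightarrow> c) at_top"
begin

text \<open>The constant \<open>c\<close> is half the limit, so that \<open>c\<close> and
  \<open>4 * c\<close> are half and twice it.\<close>

lemma rate_bounds:
  obtains c t0 where "0 < c" "1 \<le> t0"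
    "\<And>t. t0 \<le> t \<Longrightarrow> c * t powr (- \<gamma>) \<le> a t \<and> a t \<le> 4 * c * t powr (- \<gamma>)"
proof -
  obtain c where c: "c > 0" "((\<lambda>t. t powr \<gamma> * a t) \<longlongrightarrow> c) at_top" using rate by blast
  have "\<forall>\<^sub>F t in at_top. c / 2 < t powr \<gamma> * a t" "\<forall>\<^sub>F t in at_top. t powr \<gamma> * a t < 2 * c"
    using order_tendstoD(1)[OF c(2), of "c / 2"] order_tendstoD(2)[OF c(2), of "2 * c"] c(1) by auto
  then have "\<forall>\<^sub>F t in at_top. c / 2 < t powr \<gamma> * a t \<and> t powr \<gamma> * a t < 2 * c"
    by eventually_elim simp
  then obtain t1 where t1: "\<And>t. t1 \<le> t \<Longrightarrow> c / 2 < t powr \<gamma> * a t \<and> t powr \<gamma> * a t < 2 * c"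
    by (auto simp: eventually_at_top_linorder)
  show thesis
  proof (rule that[of "c/2" "max 1 t1"])
    fix t assume t: "max 1 t1 \<le> t"
    then have "t1 \<le> t" "0 < t powr \<gamma>" by auto
    with t1[of t] show "c / 2 * t powr (- \<gamma>) \<le> a t \<and> a t \<le> 4 * (c / 2) * t powr (- \<gamma>)"
      by (simp add: powr_minus field_simps)
  qed (use c in auto)
qed

lemma pos: assumes "0 \<le> t" shows "0 < a t"
proof -
  obtain c t0 where c: "0 < c" "1 \<le> t0"
    "\<And>t. t0 \<le> t \<Longrightarrow> c * t powr (- \<gamma>) \<le> a t \<and> a t \<le> 4 * c * t powr (- \<gamma>)"
    using rate_bounds by blast
  have "0 < c * (max t t0) powr (- \<gamma>)" using c by auto
  also have "\<dots> \<le> a (max t t0)" using c(3)[of "max t t0"] by auto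
  also have "\<dots> \<le> a t" using assms by (intro decr) auto
  finally show ?thesis .
qed

text \<open>The shift to \<open>1 + t\<close> removes the singularity at 0, so that one bound serves
  on the whole half-line.\<close>

lemma upper_rate: obtains C where "0 < C" "\<And>t. 0 \<le> t \<Longrightarrow> a t \<le> C * (1 + t) powr (- \<gamma>)"
proof -
  obtain c t0 where c: "0 < c" "1 \<le> t0"
    "\<And>t. t0 \<le> t \<Longrightarrow> c * t powr (- \<gamma>) \<le> a t \<and> a t \<le> 4 * c * t powr (- \<gamma>)"
    using rate_bounds by blast
  \<comment> \<open>First summand: \<open>1 + t \<le> 2 * t\<close> for \<open>t0 \<le> t\<close>,
    whence the factor \<open>2 powr \<gamma>\<close>. Second summand: before \<open>t0\<close> the
    gain is at most \<open>a 0\<close>.\<close>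
  define C where "C = 4 * c * 2 powr \<gamma> + a 0 * (1 + t0) powr \<gamma>"
  have "a t \<le> C * (1 + t) powr (- \<gamma>)" if t: "0 \<le> t" for t
  proof (cases "t0 \<le> t")
    case True
    have "a t \<le> 4 * c * t powr (- \<gamma>)" using c True by auto
    also have "t powr (- \<gamma>) = 2 powr \<gamma> * (2 * t) powr (- \<gamma>)"
      using True c by (simp add: powr_mult powr_minus)
    also have "(2 * t) powr (- \<gamma>) \<le> (1 + t) powr (- \<gamma>)"
      using True c \<gamma> by (intro powr_mono2') auto
    finally have "a t \<le> 4 * c * 2 powr \<gamma> * (1 + t) powr (- \<gamma>)"
      using c by (simp add: mult_left_mono)
    also have "\<dots> \<le> C * (1 + t) powr (- \<gamma>)"
      unfolding C_def using nonneg[of 0] by (intro mult_right_mono) auto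
    finally show ?thesis .
  next
    case False
    have "a t \<le> a 0 * 1" using decr[of 0 t] t by simp
    also have "1 \<le> (1 + t0) powr \<gamma> * (1 + t) powr (- \<gamma>)"
    proof -
      have "(1 + t) powr \<gamma> \<le> (1 + t0) powr \<gamma>"
        using False t \<gamma> by (intro powr_mono2) auto
      then show ?thesis using t by (simp add: powr_minus field_simps)
    qed
    finally have "a t \<le> a 0 * (1 + t0) powr \<gamma> * (1 + t) powr (- \<gamma>)"
      using nonneg[of 0] by (simp add: mult_left_mono)
    also have "\<dots> \<le> C * (1 + t) powr (- \<gamma>)"
      unfolding C_def using c by (intro mult_right_mono) auto
    finally show ?thesis .
  qed
  moreover have "0 < C" using c nonneg[of 0] by (auto simp: C_def intro!: add_pos_nonneg)
  ultimately show thesis using that by blast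
qed

lemma tendsto_0: "((\<lambda>t. a (max 0 t)) \<longlongrightarrow> 0) at_top"
proof -
  obtain C where C: "0 < C" "\<And>t. 0 \<le> t \<Longrightarrow> a t \<le> C * (1 + t) powr (- \<gamma>)" using upper_rate by blast
  have lim: "((\<lambda>t::real. C * (1 + t) powr (- \<gamma>)) \<longlongrightarrow> 0) at_top"
    using \<gamma> by real_asymp
  have ge: "\<forall>\<^sub>F t in at_top. 0 \<le> a (max 0 t)"
    using nonneg by (intro always_eventually) auto
  have le: "\<forall>\<^sub>F t in at_top. a (max 0 t) \<le> C * (1 + t) powr (- \<gamma>)"
    using eventually_ge_at_top[of 0] by eventually_elim (use C in \<open>auto simp: max_def\<close>)
  show ?thesis by (rule tendsto_sandwich[OF ge le tendsto_const lim])
qed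

lemma measurable_gain[measurable]: "(\<lambda>s. a (max 0 s)) \<in> borel_measurable borel"
proof -
  have "mono (\<lambda>s. - a (max 0 s))"
    by (auto intro!: monoI decr)
  then have "(\<lambda>s. - (- a (max 0 s))) \<in> borel_measurable borel"
    by (intro borel_measurable_uminus borel_measurable_mono)
  then show ?thesis by simp
qed

lemma integrable: assumes "0 \<le> s" shows "a integrable_on {s..t}"
proof -
  have "mono_on {s..t} (\<lambda>x. - a x)"
    using assms by (auto intro!: mono_onI decr)
  then have "(\<lambda>x. - (- a x)) integrable_on {s..t}"
    by (intro integrable_neg integrable_on_mono_on)
  then show ?thesis by simp
qed

text \<open>The intrinsic clock: measured by \<open>S\<close> instead of \<open>t\<close>, the drift
  has constant coefficients.\<close>

definition S :: "real \<Rightarrow> real" where "S t = integral {0..t} a"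

lemma S_0[simp]: "S 0 = 0" by (simp add: S_def)

lemma continuous_S: "continuous_on {0..t} S"
  unfolding S_def using integrable[of 0 t] by (intro indefinite_integral_continuous_1) auto

lemma S_mono: assumes "0 \<le> s" "s \<le> t" shows "S s \<le> S t"
  unfolding S_def using assms nonneg by (intro integral_subset_le integrable) auto

text \<open>A decreasing gain stays above its final value on \<open>[0, t]\<close>; with the lower
  rate this already gives growth of order \<open>t powr (1 - \<gamma>)\<close>.\<close>

lemma S_lower: assumes "0 \<le> t" shows "t * a t \<le> S t"
proof -
  have "integral {0..t} (\<lambda>_. a t) \<le> integral {0..t} a"
    using assms decr by (intro integral_le integrable) auto
  then show ?thesis using assms by (simp add: S_def)
qed

lemma S_at_top: "filterlim S at_top at_top"
proof -
  obtain c t0 where c: "0 < c" "1 \<le> t0"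
    "\<And>t. t0 \<le> t \<Longrightarrow> c * t powr (- \<gamma>) \<le> a t \<and> a t \<le> 4 * c * t powr (- \<gamma>)"
    using rate_bounds by blast
  have "filterlim (\<lambda>t::real. c * t powr (1 - \<gamma>)) at_top at_top"
    using \<gamma> c by real_asymp
  moreover have "\<forall>\<^sub>F t in at_top. c * t powr (1 - \<gamma>) \<le> S t"
    using eventually_ge_at_top[of t0]
  proof eventually_elim
    case (elim t)
    have "c * t powr (1 - \<gamma>) = t * (c * t powr (- \<gamma>))"
      using elim c by (simp add: powr_diff powr_minus field_simps)
    also have "\<dots> \<le> t * a t" using elim c by (intro mult_left_mono) auto
    also have "\<dots> \<le> S t" using elim c by (intro S_lower) auto
    finally show ?case .
  qed
  ultimately show ?thesis by (rule filterlim_at_top_mono)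
qed

text \<open>The fundamental theorem of calculus used below tolerates finitely many exceptional
  points but wants two-sided continuity, whereas \<open>piecewise_continuous_nonneg\<close> speaks
  of continuity within the half-line.\<close>

lemma isCont_gain:
  obtains X where "finite X" "\<And>s. s \<in> {0<..<t} - X \<Longrightarrow> isCont a s"
proof (cases "0 \<le> t")
  case True
  then obtain X where X: "finite X" "\<forall>t\<in>{0..t} - X. continuous (at t within {0..}) a"
    using pc unfolding piecewise_continuous_nonneg_def by meson
  show thesis
  proof (rule that[OF X(1)])
    fix s assume s: "s \<in> {0<..<t} - X"
    then have "continuous (at s within {0..}) a" using X by auto
    then have "continuous (at s within {0<..}) a" by (rule continuous_within_subset) auto
    moreover have "at s within {0<..} = at s" using s by (intro at_within_open) auto
    ultimately show "isCont a s" by simp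
  qed
qed (use that[of "{}"] in auto)

lemma S_deriv:
  assumes "0 < s" "isCont a s"
  shows "(S has_vector_derivative a s) (at s)"
proof -
  have "S = (\<lambda>t. integral {0..t} a)" by (simp add: S_def fun_eq_iff)
  moreover have "s < s + 1" by simp
  ultimately show ?thesis
    using integral_has_vector_derivative_interior[OF integrable[of 0 "s + 1"] assms(1) _ assms(2)] by simp
qed

text \<open>The weight with which the scalar equation \<open>z' = - \<mu> * a * z + a * f\<close>
  remembers its input \<open>f\<close>. Away from the jumps of \<open>a\<close> it is the derivative
  in \<open>s\<close> of \<open>exp (- \<mu> * (S t - S s)) / \<mu>\<close>; the cut-off allows
  integration over the whole line.\<close>

definition kernel :: "real \<Rightarrow> real \<Rightarrow> real \<Rightarrow> real" where
  "kernel \<mu> t s = (if s \<in> {0..t} then a s * exp (- \<mu> * (S t - S s)) else 0)"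

lemma kernel_nonneg: "0 \<le> kernel \<mu> t s"
  by (simp add: kernel_def nonneg)

lemma measurable_S[measurable]: "(\<lambda>s. S (max 0 s)) \<in> borel_measurable borel"
  by (intro borel_measurable_mono) (auto intro!: monoI S_mono)

lemma measurable_kernel[measurable]: "kernel \<mu> t \<in> borel_measurable borel"
proof -
  have "kernel \<mu> t = (\<lambda>s. if s \<in> {0..t} then a (max 0 s) * exp (- \<mu> * (S t - S (max 0 s))) else 0)"
    by (auto simp: kernel_def max_def)
  then show ?thesis by (simp only:) measurable
qed

text \<open>The kernel has the explicit antiderivative \<open>F\<close>. Stopping at
  \<open>b\<close> rather than \<open>t\<close> expresses forgetting: for fixed \<open>b\<close> the
  bound tends to 0 as \<open>S t\<close> grows.\<close>

lemma kernel_mass: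
  assumes \<mu>: "0 < \<mu>" and b: "0 \<le> b" "b \<le> t"
  shows "(\<integral>\<^sup>+s. ennreal (kernel \<mu> t s) * indicator {0..b} s \<partial>lborel)
           \<le> ennreal (exp (- \<mu> * (S t - S b)) / \<mu>)"
proof -
  obtain X where X: "finite X" "\<And>s. s \<in> {0<..<b} - X \<Longrightarrow> isCont a s"
    using isCont_gain by blast
  define F where "F s = exp (- \<mu> * (S t - S s)) / \<mu>" for s
  have F: "(kernel \<mu> t has_integral (F b - F 0)) {0..b}"
  proof (rule fundamental_theorem_of_calculus_interior_strong[OF X(1) b(1)])
    fix s assume s: "s \<in> {0<..<b} - X"
    have "(S has_real_derivative a s) (at s)"
      using S_deriv[of s] X(2)[OF s] s by (simp add: has_real_derivative_iff_has_vector_derivative)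
    then have "(F has_real_derivative kernel \<mu> t s) (at s)"
      unfolding F_def using s b \<mu> by (auto intro!: derivative_eq_intros simp: kernel_def)
    then show "(F has_vector_derivative kernel \<mu> t s) (at s)"
      by (simp add: has_real_derivative_iff_has_vector_derivative)
  qed (use \<mu> in \<open>auto simp: F_def intro!: continuous_intros continuous_S\<close>)
  have "(\<integral>\<^sup>+s. ennreal (kernel \<mu> t s) * indicator {0..b} s \<partial>lborel) = ennreal (F b - F 0)"
    using F by (intro nn_integral_has_integral_lebesgue') (auto simp: kernel_nonneg)
  also have "\<dots> \<le> ennreal (F b)"
    using \<mu> by (intro ennreal_leI) (simp add: F_def)
  finally show ?thesis by (simp add: F_def)
qed

lemma kernel_mass_total:
  assumes "0 < \<mu>" "0 \<le> t"
  shows "(\<integral>\<^sup>+s. ennreal (kernel \<mu> t s) \<partial>lborel) \<le> ennreal (1 / \<mu>)"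
proof -
  have "(\<integral>\<^sup>+s. ennreal (kernel \<mu> t s) \<partial>lborel) = (\<integral>\<^sup>+s. ennreal (kernel \<mu> t s) * indicator {0..t} s \<partial>lborel)"
    by (intro nn_integral_cong) (auto simp: kernel_def indicator_def)
  also have "\<dots> \<le> ennreal (1 / \<mu>)"
    using kernel_mass[of \<mu> t t] assms by simp
  finally show ?thesis .
qed

lemma exp_S_tendsto_0: "0 < \<mu> \<Longrightarrow> ((\<lambda>t. exp (- \<mu> * (S t - b))) \<longlongrightarrow> 0) at_top"
proof -
  assume "0 < \<mu>"
  then have "filterlim (\<lambda>t. \<mu> * (- b + S t)) at_top at_top"
    using S_at_top by (intro filterlim_tendsto_pos_mult_at_top[OF tendsto_const]
        filterlim_tendsto_add_at_top[OF tendsto_const]) auto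
  then have "((\<lambda>t. exp (- (\<mu> * (- b + S t)))) \<longlongrightarrow> 0) at_top"
    by (intro filterlim_compose[OF exp_at_bot] filterlim_compose[OF filterlim_uminus_at_bot_at_top])
  then show ?thesis by (simp add: algebra_simps)
qed

text \<open>A continuous Toeplitz lemma. Beyond a cut \<open>s0\<close> the function
  \<open>h\<close> is small and the total mass is at most \<open>1 / \<mu>\<close>; before it
  \<open>h\<close> is bounded and the mass tends to 0.\<close>

lemma moments_vanish_kernel:
  assumes \<mu>: "0 < \<mu>" and h: "moments_vanish h"
  shows "moments_vanish (\<lambda>t. \<integral>\<^sup>+s. ennreal (kernel \<mu> t s) * h s \<partial>lborel)"
proof -
  obtain B0 where "\<forall>t\<ge>0. h t \<le> ennreal B0" using h by (auto simp: moments_vanish_def)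
  then have B: "h t \<le> ennreal (max 0 B0)" if "0 \<le> t" for t
    using that by (simp add: ennreal_max_0)
  define B where "B = max 0 B0"
  have B_nonneg: "0 \<le> B" by (simp add: B_def)
  have split: "(\<integral>\<^sup>+s. ennreal (kernel \<mu> t s) * h s \<partial>lborel)
      \<le> ennreal (\<epsilon> / \<mu> + B * (exp (- \<mu> * (S t - S s0)) / \<mu>))"
    if "0 \<le> \<epsilon>" "0 \<le> s0" "s0 \<le> t" "\<And>s. s0 \<le> s \<Longrightarrow> h s \<le> ennreal \<epsilon>" for \<epsilon> s0 t
  proof -
    have "(\<integral>\<^sup>+s. ennreal (kernel \<mu> t s) * h s \<partial>lborel)
        \<le> (\<integral>\<^sup>+s. ennreal \<epsilon> * ennreal (kernel \<mu> t s)
               + ennreal B * (ennreal (kernel \<mu> t s) * indicator {0..s0} s) \<partial>lborel)"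
    proof (rule nn_integral_mono)
      fix s
      show "ennreal (kernel \<mu> t s) * h s
        \<le> ennreal \<epsilon> * ennreal (kernel \<mu> t s) + ennreal B * (ennreal (kernel \<mu> t s) * indicator {0..s0} s)"
      proof (cases "s \<in> {0..t}")
        case False
        then show ?thesis by (auto simp: kernel_def)
      next
        case True
        show ?thesis
        proof (cases "s \<le> s0")
          case False
          then have "ennreal (kernel \<mu> t s) * h s \<le> ennreal (kernel \<mu> t s) * ennreal \<epsilon>"
            using that by (intro mult_left_mono) auto
          then show ?thesis by (simp add: ac_simps add_increasing2)
        next
          case le: True
          have "ennreal (kernel \<mu> t s) * h s \<le> ennreal (kernel \<mu> t s) * ennreal B"
            using B[of s] True by (intro mult_left_mono) (auto simp: B_def)
          then show ?thesis using True le by (simp add: ac_simps add_increasing2)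
        qed
      qed
    qed
    also have "\<dots> = ennreal \<epsilon> * (\<integral>\<^sup>+s. ennreal (kernel \<mu> t s) \<partial>lborel)
       + ennreal B * (\<integral>\<^sup>+s. ennreal (kernel \<mu> t s) * indicator {0..s0} s \<partial>lborel)"
      by (subst nn_integral_add) (auto simp: nn_integral_cmult)
    also have "\<dots> \<le> ennreal \<epsilon> * ennreal (1 / \<mu>) + ennreal B * ennreal (exp (- \<mu> * (S t - S s0)) / \<mu>)"
      using that \<mu> by (intro add_mono mult_left_mono kernel_mass kernel_mass_total) auto
    also have "\<dots> = ennreal (\<epsilon> / \<mu> + B * (exp (- \<mu> * (S t - S s0)) / \<mu>))"
      using that \<mu> B_nonneg by (simp add: ennreal_mult[symmetric] ennreal_plus[symmetric] del: ennreal_plus)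
    finally show ?thesis .
  qed
  show ?thesis
    unfolding moments_vanish_def
  proof
    \<comment> \<open>The cut at 0 with \<open>\<epsilon> = B\<close> yields a bound for all
      times.\<close>
    have "(\<integral>\<^sup>+s. ennreal (kernel \<mu> t s) * h s \<partial>lborel) \<le> ennreal (B / \<mu> + B * (1 / \<mu>))"
      if "0 \<le> t" for t
    proof -
      have "(\<integral>\<^sup>+s. ennreal (kernel \<mu> t s) * h s \<partial>lborel)
          \<le> ennreal (B / \<mu> + B * (exp (- \<mu> * (S t - S 0)) / \<mu>))"
        using that B by (intro split) (auto simp: B_def)
      also have "\<dots> \<le> ennreal (B / \<mu> + B * (1 / \<mu>))"
        using \<mu> S_mono[of 0 t] that
        by (intro ennreal_leI add_left_mono mult_left_mono divide_right_mono) (auto simp: B_def)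
      finally show ?thesis .
    qed
    then show "\<exists>B. \<forall>t\<ge>0. (\<integral>\<^sup>+s. ennreal (kernel \<mu> t s) * h s \<partial>lborel) \<le> ennreal B" by blast
    show "((\<lambda>t. \<integral>\<^sup>+s. ennreal (kernel \<mu> t s) * h s \<partial>lborel) \<longlongrightarrow> 0) at_top"
    proof (rule tendsto_0_if_Limsup_eq_0_ennreal, rule antisym)
      show "Limsup at_top (\<lambda>t. \<integral>\<^sup>+s. ennreal (kernel \<mu> t s) * h s \<partial>lborel) \<le> 0"
      proof (rule ennreal_le_epsilon)
        fix e :: real assume e: "0 < e"
        \<comment> \<open>The late part contributes \<open>\<epsilon> / \<mu> = e / 2\<close>; the
          early part falls below \<open>e / 2\<close> for large \<open>t\<close>.\<close>
        define \<epsilon> where "\<epsilon> = e * \<mu> / 2"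
        have "0 < \<epsilon>" "\<epsilon> / \<mu> = e / 2" using e \<mu> by (simp_all add: \<epsilon>_def)
        then have "\<forall>\<^sub>F s in at_top. h s < ennreal \<epsilon>"
          using h by (intro order_tendstoD[of h 0]) (auto simp: moments_vanish_def)
        then obtain s1 where s1: "\<And>s. s1 \<le> s \<Longrightarrow> h s < ennreal \<epsilon>"
          by (auto simp: eventually_at_top_linorder)
        define s0 where "s0 = max 0 s1"
        have "((\<lambda>t. B * (exp (- \<mu> * (S t - S s0)) / \<mu>)) \<longlongrightarrow> B * (0 / \<mu>)) at_top"
          using \<mu> by (intro tendsto_intros exp_S_tendsto_0) auto
        then have "\<forall>\<^sub>F t in at_top. B * (exp (- \<mu> * (S t - S s0)) / \<mu>) < e / 2"
          using e by (intro order_tendstoD) auto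
        then have "\<forall>\<^sub>F t in at_top. (\<integral>\<^sup>+s. ennreal (kernel \<mu> t s) * h s \<partial>lborel) \<le> ennreal e"
          using eventually_ge_at_top[of s0]
        proof eventually_elim
          case (elim t)
          have "(\<integral>\<^sup>+s. ennreal (kernel \<mu> t s) * h s \<partial>lborel)
              \<le> ennreal (\<epsilon> / \<mu> + B * (exp (- \<mu> * (S t - S s0)) / \<mu>))"
            using \<open>0 < \<epsilon>\<close> elim s1 by (intro split) (auto simp: s0_def intro: less_imp_le)
          also have "\<dots> \<le> ennreal e"
            using elim \<open>\<epsilon> / \<mu> = e / 2\<close> by (intro ennreal_leI) linarith
          finally show ?case .
        qed
        then show "Limsup at_top (\<lambda>t. \<integral>\<^sup>+s. ennreal (kernel \<mu> t s) * h s \<partial>lborel) \<le> 0 + ennreal e"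
          by (simp add: Limsup_bounded)
      qed
    qed simp
  qed
qed

text \<open>Here \<open>g\<close> is the actual drift, only close to \<open>a * \<rho> * z\<close>;
  the deviation \<open>h\<close> collects the triggering errors and the coupling to the next
  coordinate. In \<open>ennreal\<close> the bound makes sense before the integral on the right is
  known to be finite.\<close>

lemma variation_of_constants:
  fixes z Z g :: "real \<Rightarrow> complex" and \<rho> :: complex and h :: "real \<Rightarrow> real"
  assumes t: "0 \<le> t" and \<mu>: "0 < Re \<rho>"
    and eq: "\<And>s. s \<in> {0..t} \<Longrightarrow> z s = z 0 - integral {0..s} g + Z s"
    and g: "g integrable_on {0..t}" and X: "finite X" "\<And>s. s \<in> {0<..<t} - X \<Longrightarrow> isCont g s"
    and le: "\<And>s. s \<in> {0..t} \<Longrightarrow> cmod (a s * \<rho> * z s - g s) \<le> a s * h s"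
    and h: "\<And>s. 0 \<le> h s"
    and meas[measurable]: "Z \<in> borel_measurable borel" "h \<in> borel_measurable borel"
  shows "ennreal (cmod (z t)) \<le> ennreal (exp (- Re \<rho> * S t) * (cmod (z 0) + cmod (Z t)))
    + (\<integral>\<^sup>+s. ennreal (kernel (Re \<rho>) t s) * ennreal (cmod \<rho> * cmod (Z t - Z s) + h s) \<partial>lborel)"
proof -
  define R where "R = (\<integral>\<^sup>+s. ennreal (kernel (Re \<rho>) t s) * ennreal (cmod \<rho> * cmod (Z t - Z s) + h s) \<partial>lborel)"
  define k where "k s = kernel (Re \<rho>) t s * (cmod \<rho> * cmod (Z t - Z s) + h s)" for s
  have k0: "0 \<le> k s" for s unfolding k_def using h kernel_nonneg by simp
  have [measurable]: "k \<in> borel_measurable borel" unfolding k_def by measurable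
  have R: "R = (\<integral>\<^sup>+s. ennreal (k s) \<partial>lborel)"
    unfolding R_def k_def using h kernel_nonneg by (simp add: ennreal_mult)
  have "ennreal (cmod (z t)) \<le> ennreal (exp (- Re \<rho> * S t) * (cmod (z 0) + cmod (Z t))) + R"
  proof (cases "R = \<top>")
    \<comment> \<open>An infinite \<open>R\<close> makes the bound trivial; a finite one makes
      \<open>k\<close> gauge integrable, so that it can dominate \<open>G\<close>.\<close>
    case False
    then obtain r where r: "R = ennreal r" "0 \<le> r" by (metis ennreal_cases)
    have kint: "(k has_integral r) UNIV"
      using r R k0 by (intro nn_integral_has_integral) auto
    have k_on: "k integrable_on {0..t}"
      using kint by (intro integrable_on_subinterval[of _ UNIV]) auto
    have "integral {0..t} k \<le> integral UNIV k"
      using k_on kint k0 by (intro integral_subset_le) auto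
    then have kle: "integral {0..t} k \<le> r"
      using kint by (simp add: integral_unique)
    obtain X' where X': "finite X'" "\<And>s. s \<in> {0<..<t} - X' \<Longrightarrow> isCont a s"
      using isCont_gain by blast
    \<comment> \<open>\<open>Y s = z s + (Z t - Z s)\<close>, in particular
      \<open>Y t = z t\<close>; the factor \<open>E\<close> is \<open>exp (\<rho> * S s)\<close>
      normalised to 1 at the end time.\<close>
    define Y where "Y s = z 0 - integral {0..s} g + Z t" for s
    define E where "E s = exp (- \<rho> * complex_of_real (S t - S s))" for s
    define G where "G s = E s * (\<rho> * a s * Y s - g s)" for s
    have Z0: "Z 0 = 0" using eq[of 0] t by simp
    have int: "(G has_integral (E t * Y t - E 0 * Y 0)) {0..t}"
    proof (rule fundamental_theorem_of_calculus_interior_strong[of "X \<union> X'"])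
      fix s assume s: "s \<in> {0<..<t} - (X \<union> X')"
      have "((\<lambda>s. integral {0..s} g) has_vector_derivative g s) (at s)"
        using s X g by (intro integral_has_vector_derivative_interior[of _ t]) auto
      then have dY: "(Y has_vector_derivative - g s) (at s)"
        unfolding Y_def by (auto intro!: derivative_eq_intros)
      have "(S has_vector_derivative a s) (at s)"
        using s X' by (intro S_deriv) auto
      then have "((\<lambda>s. complex_of_real (S s)) has_vector_derivative complex_of_real (a s)) (at s)"
        by (intro has_vector_derivative_of_real) (simp add: has_real_derivative_iff_has_vector_derivative)
      from has_vector_derivative_mult_right[OF has_vector_derivative_diff[OF
            has_vector_derivative_const[of "complex_of_real (S t)"] this], of "- \<rho>"]
      have "((\<lambda>s. - \<rho> * complex_of_real (S t - S s)) has_vector_derivative \<rho> * a s) (at s)"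
        by simp
      moreover have "(exp has_field_derivative E s) (at (- \<rho> * complex_of_real (S t - S s)))"
        unfolding E_def by (auto intro!: derivative_eq_intros)
      ultimately have "(exp \<circ> (\<lambda>s. - \<rho> * complex_of_real (S t - S s)) has_vector_derivative (\<rho> * a s) * E s) (at s)"
        by (rule field_vector_diff_chain_at)
      moreover have "exp \<circ> (\<lambda>s. - \<rho> * complex_of_real (S t - S s)) = E"
        by (simp add: E_def fun_eq_iff)
      ultimately have dE: "(E has_vector_derivative (\<rho> * a s) * E s) (at s)" by simp
      show "((\<lambda>s. E s * Y s) has_vector_derivative G s) (at s)"
        using has_vector_derivative_mult[OF dE dY] by (simp add: G_def algebra_simps)
    next
      have "continuous_on {0..t} (\<lambda>s. integral {0..s} g)"
        using g by (rule indefinite_integral_continuous_1)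
      then show "continuous_on {0..t} (\<lambda>s. E s * Y s)"
        unfolding E_def Y_def by (intro continuous_intros continuous_S)
    qed (use X X' t in auto)
    have "norm (integral {0..t} G) \<le> integral {0..t} k"
    proof (rule integral_norm_bound_integral)
      fix s assume s: "s \<in> {0..t}"
      have Ys: "Y s = z s + (Z t - Z s)" using eq[OF s] by (simp add: Y_def)
      have "cmod (\<rho> * a s * Y s - g s) = cmod (\<rho> * a s * (Z t - Z s) + (a s * \<rho> * z s - g s))"
        unfolding Ys by (simp add: algebra_simps)
      also have "\<dots> \<le> cmod (\<rho> * a s * (Z t - Z s)) + a s * h s"
        using le[OF s] by (intro norm_triangle_le add_left_mono)
      also have "\<dots> = a s * (cmod \<rho> * cmod (Z t - Z s) + h s)"
        using nonneg[of s] s by (simp add: norm_mult distrib_left mult.assoc mult.left_commute)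
      finally have "cmod (\<rho> * a s * Y s - g s) \<le> a s * (cmod \<rho> * cmod (Z t - Z s) + h s)" .
      moreover have "cmod (E s) = exp (- Re \<rho> * (S t - S s))"
        by (simp add: E_def)
      ultimately have "norm (G s) \<le> exp (- Re \<rho> * (S t - S s)) * (a s * (cmod \<rho> * cmod (Z t - Z s) + h s))"
        unfolding G_def norm_mult by (simp add: mult_left_mono)
      then show "norm (G s) \<le> k s"
        using s by (simp add: k_def kernel_def mult.assoc mult.left_commute mult.commute)
    qed (use int k_on in auto)
    then have "cmod (E t * Y t - E 0 * Y 0) \<le> r"
      using int kle by (simp add: integral_unique)
    moreover have "E t * Y t = z t" using eq[of t] t by (simp add: E_def Y_def)
    \<comment> \<open>At time 0 the integral is empty, so \<open>Y 0 = z 0 + Z t\<close>: the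
      initial value and the whole noise are damped together.\<close>
    moreover have "cmod (E 0 * Y 0) \<le> exp (- Re \<rho> * S t) * (cmod (z 0) + cmod (Z t))"
      by (simp add: E_def Y_def norm_mult norm_triangle_ineq mult_left_mono)
    ultimately have "cmod (z t) \<le> exp (- Re \<rho> * S t) * (cmod (z 0) + cmod (Z t)) + r"
      using norm_triangle_sub[of "z t" "E 0 * Y 0"] by simp
    then show ?thesis
      using r by (simp add: ennreal_plus[symmetric] ennreal_leI del: ennreal_plus)
  qed simp
  then show ?thesis by (simp add: R_def)
qed

text \<open>The right end points in the Riemann sums make the variance a lower sum of the decreasing function
  \<open>(1 + u) powr (- 2 * \<gamma>)\<close>, so that it telescopes.\<close>

lemma grid_square_sum:
  obtains C where "0 < C" "\<And>s t n. 0 \<le> s \<Longrightarrow> s < t \<Longrightarrow> 0 < n \<Longrightarrow>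
    (\<Sum>k<n. (a (grid s t n (Suc k)))\<^sup>2 * ((t - s) / real n)) \<le> C * (1 + s) powr (1 - 2 * \<gamma>)"
proof -
  obtain C where C: "0 < C" "\<And>t. 0 \<le> t \<Longrightarrow> a t \<le> C * (1 + t) powr (- \<gamma>)" using upper_rate by blast
  define G where "G u = (1 + u) powr (1 - 2 * \<gamma>)" for u :: real
  \<comment> \<open>The mean value theorem compares a cell with the antiderivative
    \<open>G / (1 - 2 * \<gamma>)\<close> of \<open>(1 + u) powr (- 2 * \<gamma>)\<close>; as
    \<open>\<gamma> > 1/2\<close>, \<open>G\<close> decreases.\<close>
  have step: "(1 + v) powr (- 2 * \<gamma>) * (v - u) \<le> (G u - G v) / (2 * \<gamma> - 1)" if "0 \<le> u" "u < v" for u v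
  proof -
    have "\<exists>z>u. z < v \<and> G v - G u = (v - u) * ((1 - 2 * \<gamma>) * (1 + z) powr (- 2 * \<gamma>))"
      unfolding G_def using that by (intro MVT2) (auto intro!: derivative_eq_intros)
    then obtain z where z: "u < z" "z < v" "G v - G u = (v - u) * ((1 - 2 * \<gamma>) * (1 + z) powr (- 2 * \<gamma>))"
      by blast
    have "(1 + v) powr (- 2 * \<gamma>) * (v - u) \<le> (1 + z) powr (- 2 * \<gamma>) * (v - u)"
      using z that \<gamma> by (intro mult_right_mono powr_mono2') auto
    also have "\<dots> = (G u - G v) / (2 * \<gamma> - 1)"
      using z(3) \<gamma> by (simp add: field_simps)
    finally show ?thesis .
  qed
  show thesis
  proof (rule that[of "C\<^sup>2 / (2 * \<gamma> - 1)"])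
    fix s t n assume s: "(0::real) \<le> s" "s < t" "0 < (n::nat)"
    let ?g = "grid s t n"
    have \<Delta>: "0 < (t - s) / real n" using s by simp
    have g0: "0 \<le> ?g k" for k using s by (simp add: grid_def)
    have lt: "?g k < ?g (Suc k)" for k using grid_Suc_diff[of s t n k] \<Delta> by linarith
    have "(\<Sum>k<n. (a (?g (Suc k)))\<^sup>2 * ((t - s) / real n)) \<le> (\<Sum>k<n. C\<^sup>2 / (2 * \<gamma> - 1) * (G (?g k) - G (?g (Suc k))))"
    proof (rule sum_mono)
      fix k
      have "(a (?g (Suc k)))\<^sup>2 \<le> (C * (1 + ?g (Suc k)) powr (- \<gamma>))\<^sup>2"
        by (intro power_mono C nonneg g0)
      also have "\<dots> = C\<^sup>2 * (1 + ?g (Suc k)) powr (- 2 * \<gamma>)"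
        by (simp add: power_mult_distrib power2_eq_square powr_add[symmetric])
      finally have "(a (?g (Suc k)))\<^sup>2 * ((t - s) / real n)
          \<le> C\<^sup>2 * (1 + ?g (Suc k)) powr (- 2 * \<gamma>) * ((t - s) / real n)"
        using \<Delta> by (intro mult_right_mono) auto
      also have "\<dots> = C\<^sup>2 * ((1 + ?g (Suc k)) powr (- 2 * \<gamma>) * (?g (Suc k) - ?g k))"
        by (simp add: grid_Suc_diff)
      also have "\<dots> \<le> C\<^sup>2 * ((G (?g k) - G (?g (Suc k))) / (2 * \<gamma> - 1))"
        using step[OF g0 lt] by (intro mult_left_mono) auto
      finally show "(a (?g (Suc k)))\<^sup>2 * ((t - s) / real n)
          \<le> C\<^sup>2 / (2 * \<gamma> - 1) * (G (?g k) - G (?g (Suc k)))" by simp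
    qed
    also have "\<dots> = C\<^sup>2 / (2 * \<gamma> - 1) * (G (?g 0) - G (?g n))"
      by (simp only: sum_distrib_left[symmetric] sum_lessThan_telescope'[of "\<lambda>k. G (?g k)" n])
    \<comment> \<open>Dropping the nonnegative value of \<open>G\<close> at the right end makes the
      bound uniform in \<open>t\<close>.\<close>
    also have "\<dots> \<le> C\<^sup>2 / (2 * \<gamma> - 1) * G s"
      using \<gamma> by (intro mult_left_mono) (auto simp: G_def)
    finally show "(\<Sum>k<n. (a (?g (Suc k)))\<^sup>2 * ((t - s) / real n)) \<le> C\<^sup>2 / (2 * \<gamma> - 1) * (1 + s) powr (1 - 2 * \<gamma>)"
      by (simp add: G_def)
  qed (use C \<gamma> in auto)
qed

text \<open>The integral is an almost sure limit of Gaussian sums, and Fatou's lemma carries their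
  moment bound over without identifying the law of the limit. The \<open>p\<close>-th moment scales
  as the variance to the power \<open>p / 2\<close>, hence the exponent. The constant is chosen
  before \<open>W\<close>, \<open>D\<close>, \<open>s\<close> and \<open>t\<close>, so it serves all
  edges and times.\<close>

lemma brownian_integral_moment:
  assumes M: "prob_space M" and p: "0 < p"
  obtains C where "\<And>W D s t. std_brownian M W \<Longrightarrow> 0 \<le> s \<Longrightarrow> s \<le> t \<Longrightarrow>
     (AE \<omega> in M. has_rs_integral a (\<lambda>u. W u \<omega>) s t (D \<omega>)) \<Longrightarrow>
     (\<integral>\<^sup>+\<omega>. ennreal (\<bar>D \<omega>\<bar> powr p) \<partial>M) \<le> ennreal (C * (1 + s) powr ((1 - 2 * \<gamma>) * (p / 2)))"
proof -
  interpret prob_space M by (rule M)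
  obtain C where C: "0 < C" "\<And>s t n. 0 \<le> s \<Longrightarrow> s < t \<Longrightarrow> 0 < n \<Longrightarrow>
    (\<Sum>k<n. (a (grid s t n (Suc k)))\<^sup>2 * ((t - s) / real n)) \<le> C * (1 + s) powr (1 - 2 * \<gamma>)"
    using grid_square_sum by blast
  define C' where "C' = C powr (p / 2) * normal_abs_moment p"
  have C': "0 \<le> C'" by (simp add: C'_def normal_abs_moment_nonneg)
  show thesis
  proof (rule that[of C'])
    fix W D s t assume W: "std_brownian M W" and s: "0 \<le> s" "s \<le> t"
      and D: "AE \<omega> in M. has_rs_integral a (\<lambda>u. W u \<omega>) s t (D \<omega>)"
    let ?R = "\<lambda>n \<omega>. rs_sum a (\<lambda>u. W u \<omega>) s t n"
    let ?B = "ennreal (C' * (1 + s) powr ((1 - 2 * \<gamma>) * (p / 2)))"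
    have lim: "AE \<omega> in M. (\<lambda>n. ?R n \<omega>) \<longlonglongrightarrow> D \<omega>"
      using D by eventually_elim (rule rs_sum_tendsto[OF _ s(2)])
    show "(\<integral>\<^sup>+\<omega>. ennreal (\<bar>D \<omega>\<bar> powr p) \<partial>M) \<le> ?B"
    proof (cases "s = t")
      \<comment> \<open>This interval would give variance 0, which a normal density
        excludes.\<close>
      case True
      have "AE \<omega> in M. D \<omega> = 0"
        using D by eventually_elim (use True has_rs_integral_degenerate in blast)
      then have "(\<integral>\<^sup>+\<omega>. ennreal (\<bar>D \<omega>\<bar> powr p) \<partial>M) = (\<integral>\<^sup>+\<omega>. 0 \<partial>M)"
        by (intro nn_integral_cong_AE, eventually_elim) auto
      then show ?thesis by simp
    next
      case False
      with s have st: "s < t" by simp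
      have meas: "?R n \<in> borel_measurable M" for n
      proof -
        have "W (grid s t n k) \<in> borel_measurable M" for k
          using W s unfolding std_brownian_def by (auto simp: grid_def)
        then show ?thesis unfolding rs_sum_def by measurable
      qed
      have bound: "(\<integral>\<^sup>+\<omega>. ennreal (\<bar>?R n \<omega>\<bar> powr p) \<partial>M) \<le> ?B" if n: "0 < n" for n
      proof -
        define v where "v = (\<Sum>k<n. (a (grid s t n (Suc k)))\<^sup>2 * ((t - s) / real n))"
        have g0: "0 \<le> grid s t n k" for k using s by (simp add: grid_def)
        have "0 < v"
          unfolding v_def using n st pos[OF g0] by (intro sum_pos mult_pos_pos zero_less_power) auto
        have "distributed M lborel (?R n) (normal_density 0 (sqrt v))"
          unfolding v_def by (rule brownian_rs_sum_normal[OF W s(1) st n pos])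
        then have "(\<integral>\<^sup>+\<omega>. ennreal (\<bar>?R n \<omega>\<bar> powr p) \<partial>M) = ennreal (sqrt v powr p * normal_abs_moment p)"
          using \<open>0 < v\<close> p by (intro normal_abs_moment) auto
        also have "sqrt v powr p = v powr (p / 2)"
          using \<open>0 < v\<close> by (simp add: powr_half_sqrt[symmetric] powr_powr)
        also have "v powr (p / 2) * normal_abs_moment p \<le> C' * (1 + s) powr ((1 - 2 * \<gamma>) * (p / 2))"
        proof -
          have "v powr (p / 2) \<le> (C * (1 + s) powr (1 - 2 * \<gamma>)) powr (p / 2)"
            using C(2)[OF s(1) st n] \<open>0 < v\<close> p by (intro powr_mono2) (auto simp: v_def)
          also have "\<dots> = C powr (p / 2) * (1 + s) powr ((1 - 2 * \<gamma>) * (p / 2))"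
            using C by (simp add: powr_mult powr_powr)
          finally have "v powr (p / 2) * normal_abs_moment p
              \<le> (C powr (p / 2) * (1 + s) powr ((1 - 2 * \<gamma>) * (p / 2))) * normal_abs_moment p"
            using normal_abs_moment_nonneg by (rule mult_right_mono)
          then show ?thesis by (simp add: C'_def mult.assoc mult.left_commute mult.commute)
        qed
        finally show ?thesis by (simp add: ennreal_leI)
      qed
      have "(\<integral>\<^sup>+\<omega>. ennreal (\<bar>D \<omega>\<bar> powr p) \<partial>M) = (\<integral>\<^sup>+\<omega>. liminf (\<lambda>n. ennreal (\<bar>?R n \<omega>\<bar> powr p)) \<partial>M)"
      proof (rule nn_integral_cong_AE, use lim in eventually_elim)
        case (elim \<omega>)
        have "(\<lambda>n. \<bar>?R n \<omega>\<bar> powr p) \<longlonglongrightarrow> \<bar>D \<omega>\<bar> powr p"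
          using p elim by (intro tendsto_powr' tendsto_rabs tendsto_const) auto
        then show ?case by (intro lim_imp_Liminf[symmetric]) (auto intro: tendsto_ennrealI)
      qed
      also have "\<dots> \<le> liminf (\<lambda>n. \<integral>\<^sup>+\<omega>. ennreal (\<bar>?R n \<omega>\<bar> powr p) \<partial>M)"
        using meas by (intro nn_integral_liminf) measurable
      also have "\<dots> \<le> liminf (\<lambda>n. ?B)"
        by (intro Liminf_mono eventually_mono[OF eventually_gt_at_top[of 0]] bound)
      also have "\<dots> = ?B" by (rule Liminf_const) simp
      finally show ?thesis .
    qed
  qed
qed

text \<open>Transfers a pathwise bound to moments. The input \<open>F\<close> may depend on the end
  time \<open>t\<close>, as \<open>Z t - Z s\<close> does, but its moments must be bounded by a
  function of \<open>s\<close> alone, to which \<open>moments_vanish_kernel\<close> applies.\<close>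

lemma moments_vanish_step:
  fixes u :: "real \<Rightarrow> 'a \<Rightarrow> real"
  assumes M: "prob_space M" and p: "1 \<le> p" and \<mu>: "0 < \<mu>"
    and le: "\<And>t. 0 \<le> t \<Longrightarrow> AE \<omega> in M. ennreal (u t \<omega>) \<le> ennreal (exp (- \<mu> * S t) * b t \<omega>)
        + (\<integral>\<^sup>+s. ennreal (kernel \<mu> t s) * ennreal (F t s \<omega>) \<partial>lborel)"
    and u: "\<And>t \<omega>. 0 \<le> u t \<omega>" and b: "\<And>t \<omega>. 0 \<le> b t \<omega>" and F: "\<And>t s \<omega>. 0 \<le> F t s \<omega>"
    and b_meas: "\<And>t. b t \<in> borel_measurable M"
    and F_meas: "\<And>t. (\<lambda>(s, \<omega>). F t s \<omega>) \<in> borel_measurable (borel \<Otimes>\<^sub>M M)"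
    and b_mom: "\<And>t. 0 \<le> t \<Longrightarrow> pmoment M p (b t) \<le> ennreal B"
    and F_mom: "\<And>s t. 0 \<le> s \<Longrightarrow> s \<le> t \<Longrightarrow> pmoment M p (F t s) \<le> h s"
    and h: "moments_vanish h"
  shows "moments_vanish (\<lambda>t. pmoment M p (u t))"
proof -
  interpret prob_space M by (rule M)
  interpret pair_sigma_finite lborel M ..
  \<comment> \<open>The constant of Jensen's inequality for a kernel of mass at most
    \<open>1 / \<mu>\<close>.\<close>
  define K where "K = ennreal ((1 / \<mu>) powr (p - 1))"
  have bound: "pmoment M p (u t) \<le> ennreal (2 powr p) * (ennreal (exp (- \<mu> * S t) powr p * max 0 B)
      + K * (\<integral>\<^sup>+s. ennreal (kernel \<mu> t s) * h s \<partial>lborel))" if t: "0 \<le> t" for t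
  proof -
    have Fm[measurable]: "(\<lambda>(s, \<omega>). F t s \<omega>) \<in> borel_measurable (lborel \<Otimes>\<^sub>M M)"
      using F_meas[of t] by (simp cong: measurable_cong_sets)
    have Fm2[measurable]: "(\<lambda>s. F t s \<omega>) \<in> borel_measurable lborel" if "\<omega> \<in> space M" for \<omega>
      using measurable_compose[OF measurable_Pair2'[OF that] Fm] by simp
    have Fm1: "F t s \<in> borel_measurable M" for s
      using measurable_compose[OF measurable_Pair1'[of s lborel M] Fm] by simp
    have pair: "(\<lambda>(s, \<omega>). ennreal (kernel \<mu> t s) * ennreal (F t s \<omega> powr p)) \<in> borel_measurable (lborel \<Otimes>\<^sub>M M)"
      by measurable
    have int_meas: "(\<lambda>\<omega>. \<integral>\<^sup>+s. ennreal (kernel \<mu> t s) * ennreal (F t s \<omega> powr p) \<partial>lborel) \<in> borel_measurable M"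
      by (rule lborel.borel_measurable_nn_integral) (use pair in measurable)
    note b_meas[measurable] int_meas[measurable]
    have "AE \<omega> in M. ennreal (u t \<omega> powr p) \<le> ennreal (2 powr p) *
       (ennreal (exp (- \<mu> * S t) powr p) * ennreal (b t \<omega> powr p)
         + K * (\<integral>\<^sup>+s. ennreal (kernel \<mu> t s) * ennreal (F t s \<omega> powr p) \<partial>lborel))"
      using le[OF t] AE_space
    proof eventually_elim
      case (elim \<omega>)
      define c where "c = exp (- \<mu> * S t) * b t \<omega>"
      \<comment> \<open>The excess of \<open>u t \<omega>\<close> over the damped initial term, cut
        at 0 so that Jensen's inequality applies to it.\<close>
      define v where "v = max 0 (u t \<omega> - c)"
      have c0: "0 \<le> c" using b by (simp add: c_def)
      have v0: "0 \<le> v" by (simp add: v_def)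
      have "ennreal v = ennreal (u t \<omega> - c)" by (simp add: v_def ennreal_max_0)
      also have "\<dots> = ennreal (u t \<omega>) - ennreal c" using c0 by (rule ennreal_minus[symmetric])
      also have "\<dots> \<le> (\<integral>\<^sup>+s. ennreal (kernel \<mu> t s) * ennreal (F t s \<omega>) \<partial>lborel)"
        using elim(1) unfolding c_def[symmetric] by (simp add: ennreal_minus_le_iff)
      finally have "ennreal v \<le> (\<integral>\<^sup>+s. ennreal (kernel \<mu> t s) * ennreal (F t s \<omega>) \<partial>lborel)" .
      then have J: "ennreal (v powr p) \<le> K * (\<integral>\<^sup>+s. ennreal (kernel \<mu> t s) * ennreal (F t s \<omega> powr p) \<partial>lborel)"
        unfolding K_def using elim(2) p \<mu> t F v0
        by (intro nn_integral_jensen_powr kernel_mass_total) auto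
      have "u t \<omega> powr p \<le> (c + v) powr p"
        using u p by (intro powr_mono2) (auto simp: v_def)
      also have "\<dots> \<le> 2 powr p * (c powr p + v powr p)"
        using powr_sum_le[of "UNIV :: bool set" "\<lambda>b. if b then v else c" p] c0 v0 p
        by (simp add: UNIV_bool)
      also have "c powr p = exp (- \<mu> * S t) powr p * b t \<omega> powr p"
        using b by (simp add: c_def powr_mult)
      finally have "ennreal (u t \<omega> powr p)
          \<le> ennreal (2 powr p * (exp (- \<mu> * S t) powr p * b t \<omega> powr p + v powr p))"
        by (rule ennreal_leI)
      also have "\<dots> = ennreal (2 powr p) * (ennreal (exp (- \<mu> * S t) powr p) * ennreal (b t \<omega> powr p) + ennreal (v powr p))"
        by (simp add: ennreal_mult)
      also have "\<dots> \<le> ennreal (2 powr p) * (ennreal (exp (- \<mu> * S t) powr p) * ennreal (b t \<omega> powr p)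
         + K * (\<integral>\<^sup>+s. ennreal (kernel \<mu> t s) * ennreal (F t s \<omega> powr p) \<partial>lborel))"
        using J by (intro mult_left_mono add_left_mono) auto
      finally show ?case .
    qed
    then have "pmoment M p (u t) \<le> (\<integral>\<^sup>+\<omega>. ennreal (2 powr p) *
       (ennreal (exp (- \<mu> * S t) powr p) * ennreal (b t \<omega> powr p)
         + K * (\<integral>\<^sup>+s. ennreal (kernel \<mu> t s) * ennreal (F t s \<omega> powr p) \<partial>lborel)) \<partial>M)"
      unfolding pmoment_def by (rule nn_integral_mono_AE)
    also have "\<dots> = ennreal (2 powr p) * (ennreal (exp (- \<mu> * S t) powr p) * pmoment M p (b t)
         + K * (\<integral>\<^sup>+\<omega>. (\<integral>\<^sup>+s. ennreal (kernel \<mu> t s) * ennreal (F t s \<omega> powr p) \<partial>lborel) \<partial>M))"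
      unfolding pmoment_def by (simp add: nn_integral_cmult nn_integral_add)
    \<comment> \<open>Tonelli's theorem brings the expectation inside, where it meets
      \<open>F\<close> at a single time \<open>s\<close>.\<close>
    also have "(\<integral>\<^sup>+\<omega>. (\<integral>\<^sup>+s. ennreal (kernel \<mu> t s) * ennreal (F t s \<omega> powr p) \<partial>lborel) \<partial>M)
        = (\<integral>\<^sup>+s. (\<integral>\<^sup>+\<omega>. ennreal (kernel \<mu> t s) * ennreal (F t s \<omega> powr p) \<partial>M) \<partial>lborel)"
      using pair by (rule Fubini')
    also have "\<dots> = (\<integral>\<^sup>+s. ennreal (kernel \<mu> t s) * pmoment M p (F t s) \<partial>lborel)"
      unfolding pmoment_def using Fm1 by (simp add: nn_integral_cmult)
    also have "\<dots> \<le> (\<integral>\<^sup>+s. ennreal (kernel \<mu> t s) * h s \<partial>lborel)"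
    proof (rule nn_integral_mono)
      fix s
      show "ennreal (kernel \<mu> t s) * pmoment M p (F t s) \<le> ennreal (kernel \<mu> t s) * h s"
        using F_mom[of s t] by (cases "s \<in> {0..t}") (auto simp: kernel_def intro!: mult_left_mono)
    qed
    also have "pmoment M p (b t) \<le> ennreal (max 0 B)" using b_mom[OF t] by (simp add: ennreal_max_0)
    finally show ?thesis
      by (simp add: mult_left_mono add_mono ennreal_mult)
  qed
  have "((\<lambda>t. exp (- \<mu> * S t) powr p * max 0 B) \<longlongrightarrow> 0 powr p * max 0 B) at_top"
    using exp_S_tendsto_0[OF \<mu>, of 0] p by (intro tendsto_mult tendsto_powr' tendsto_const) auto
  moreover have "exp (- \<mu> * S t) powr p * max 0 B \<le> 1 * max 0 B" if "0 \<le> t" for t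
    using S_mono[of 0 t] that \<mu> p by (intro mult_right_mono powr_le1) auto
  ultimately have "moments_vanish (\<lambda>t. ennreal (exp (- \<mu> * S t) powr p * max 0 B))"
    by (intro moments_vanish_real) auto
  then have "moments_vanish (\<lambda>t. ennreal (2 powr p) * (ennreal (exp (- \<mu> * S t) powr p * max 0 B)
      + K * (\<integral>\<^sup>+s. ennreal (kernel \<mu> t s) * h s \<partial>lborel)))"
    unfolding K_def by (intro moments_vanish_cmult moments_vanish_add moments_vanish_kernel \<mu> h)
  then show ?thesis using bound by (rule moments_vanish_mono)
qed

text \<open>Strictly between two instants a larger error would put \<open>t\<close> into the set
  whose infimum is the next instant; at the instant itself the error is 0.\<close>

lemma trigger_error:
  assumes step: "\<And>k. \<tau> (Suc k) = Inf (ereal ` {t. ereal t > \<tau> k \<and> (\<xi> (real_of_ereal (\<tau> k)) - \<xi> t)\<^sup>2 \<ge> a t})"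
    and cover: "\<And>t. 0 \<le> t \<Longrightarrow> \<exists>k. \<tau> k \<le> ereal t \<and> ereal t < \<tau> (Suc k)"
    and hold: "\<And>k t. \<tau> k \<le> ereal t \<Longrightarrow> ereal t < \<tau> (Suc k) \<Longrightarrow> \<xi>t t = \<xi> (real_of_ereal (\<tau> k))"
    and t: "0 \<le> t"
  shows "\<bar>\<xi>t t - \<xi> t\<bar> \<le> sqrt (a t)"
proof -
  obtain k where k: "\<tau> k \<le> ereal t" "ereal t < \<tau> (Suc k)" using cover[OF t] by blast
  have "(\<xi>t t - \<xi> t)\<^sup>2 \<le> a t"
  proof (cases "\<tau> k = ereal t")
    case True
    then show ?thesis using hold[OF k] nonneg[OF t] by simp
  next
    case False
    show ?thesis
    proof (rule ccontr)
      assume "\<not> (\<xi>t t - \<xi> t)\<^sup>2 \<le> a t"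
      then have "ereal t \<in> ereal ` {t. ereal t > \<tau> k \<and> (\<xi> (real_of_ereal (\<tau> k)) - \<xi> t)\<^sup>2 \<ge> a t}"
        using False k hold[OF k] by auto
      then have "\<tau> (Suc k) \<le> ereal t" unfolding step by (rule Inf_lower)
      then show False using k by simp
    qed
  qed
  then show ?thesis by (intro real_le_rsqrt) simp
qed

text \<open>The broadcast state is constant between instants. By \<open>cover\<close> the time
  \<open>t\<close> precedes some \<open>\<tau> (Suc k)\<close>, so only finitely many instants lie
  in \<open>[0, t]\<close>; this is where the absence of Zeno behaviour enters.\<close>

lemma trigger_isCont:
  assumes step: "\<And>k. \<tau> (Suc k) = Inf (ereal ` {t. ereal t > \<tau> k \<and> (\<xi> (real_of_ereal (\<tau> k)) - \<xi> t)\<^sup>2 \<ge> a t})"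
    and cover: "\<And>t. 0 \<le> t \<Longrightarrow> \<exists>k. \<tau> k \<le> ereal t \<and> ereal t < \<tau> (Suc k)"
    and hold: "\<And>k t. \<tau> k \<le> ereal t \<Longrightarrow> ereal t < \<tau> (Suc k) \<Longrightarrow> \<xi>t t = \<xi> (real_of_ereal (\<tau> k))"
  obtains X where "finite X" "\<And>s. s \<in> {0<..<t} - X \<Longrightarrow> isCont \<xi>t s"
proof (cases "0 \<le> t")
  case True
  have "\<tau> k \<le> \<tau> (Suc k)" for k unfolding step by (rule Inf_greatest) auto
  then have mono: "\<tau> j \<le> \<tau> k" if "j \<le> k" for j k using that by (rule lift_Suc_mono_le)
  obtain k where k: "\<tau> k \<le> ereal t" "ereal t < \<tau> (Suc k)" using cover[OF True] by blast
  show thesis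
  proof (rule that[of "(\<lambda>j. real_of_ereal (\<tau> j)) ` {..k}"])
    fix s assume s: "s \<in> {0<..<t} - (\<lambda>j. real_of_ereal (\<tau> j)) ` {..k}"
    then obtain j where j: "\<tau> j \<le> ereal s" "ereal s < \<tau> (Suc j)" using cover[of s] by auto
    have "j \<le> k"
    proof (rule ccontr)
      assume "\<not> j \<le> k"
      then have "\<tau> (Suc k) \<le> \<tau> j" by (intro mono) simp
      then have "ereal t < ereal s" using k j by (meson less_le_trans order_trans)
      then show False using s by simp
    qed
    then have "real_of_ereal (\<tau> j) \<noteq> s" using s by auto
    then have lt: "\<tau> j < ereal s" using j by (metis order_le_less real_of_ereal.simps(1))
    have "open {u. \<tau> j < ereal u}" "open {u. ereal u < \<tau> (Suc j)}"
      by (intro open_Collect_less continuous_intros)+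
    then have "open ({u. \<tau> j < ereal u} \<inter> {u. ereal u < \<tau> (Suc j)})" by (rule open_Int)
    then have "\<forall>\<^sub>F u in nhds s. u \<in> {u. \<tau> j < ereal u} \<inter> {u. ereal u < \<tau> (Suc j)}"
      using lt j by (intro eventually_nhds_in_open) auto
    then have "\<forall>\<^sub>F u in nhds s. \<xi>t u = \<xi> (real_of_ereal (\<tau> j))"
      by eventually_elim (auto intro!: hold)
    then show "isCont \<xi>t s" by (subst isCont_cong) auto
  qed auto
qed (use that[of "{}"] in auto)

end

subsection \<open>Spectrum of the Laplacian\<close>

text \<open>Rows of the Laplacian sum to 0, so it acts through differences. Real vectors occur in
  the maximum principle, complex ones as eigenvectors.\<close>

lemma laplacian_sum:
  fixes v :: "nat \<Rightarrow> 'b::real_algebra_1"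
  assumes "i < N"
  shows "(\<Sum>l<N. of_real (laplacian N A i l) * v l) = (\<Sum>l\<in>{..<N} - {i}. of_real (A i l) * (v i - v l))"
proof -
  have "(\<Sum>l<N. of_real (laplacian N A i l) * v l)
      = of_real (laplacian N A i i) * v i + (\<Sum>l\<in>{..<N} - {i}. of_real (laplacian N A i l) * v l)"
    using assms by (subst sum.remove[of _ i]) auto
  also have "(\<Sum>l\<in>{..<N} - {i}. of_real (laplacian N A i l) * v l) = (\<Sum>l\<in>{..<N} - {i}. - of_real (A i l) * v l)"
    by (intro sum.cong) (auto simp: laplacian_def)
  also have "of_real (laplacian N A i i) * v i = (\<Sum>l\<in>{..<N} - {i}. of_real (A i l) * v i)"
    by (simp add: laplacian_def sum_distrib_right)
  finally show ?thesis
    by (simp add: sum.distrib[symmetric] right_diff_distrib)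
qed

text \<open>Maximum principle: where \<open>u\<close> is maximal, a vanishing sum of nonnegative
  weighted differences forces the same value at every in-neighbour. Following a path backwards, the
  maximum is reached at the root \<open>k\<close>.\<close>

lemma laplacian_kernel_le_root:
  fixes u :: "nat \<Rightarrow> real"
  assumes nn: "\<forall>i<N. \<forall>j<N. A i j \<ge> 0"
    and ker: "\<And>i. i < N \<Longrightarrow> (\<Sum>l<N. laplacian N A i l * u l) = 0"
    and root: "\<forall>i<N. (k, i) \<in> (edges N A)\<^sup>*" and i: "i < N"
  shows "u i \<le> u k"
proof -
  define m where "m = Max (u ` {..<N})"
  have le: "u j \<le> m" if "j < N" for j unfolding m_def using that by auto
  have "m \<in> u ` {..<N}" unfolding m_def using i by (intro Max_in) auto
  then obtain j where j: "j < N" "u j = m" by auto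
  have "u k = m"
    using root[rule_format, OF j(1)]
  proof (induction rule: converse_rtrancl_induct)
    case base show ?case by (rule j)
  next
    case (step y z)
    then have yz: "y < N" "z < N" "y \<noteq> z" "0 < A z y" by (auto simp: edges_def)
    have "(\<Sum>l\<in>{..<N} - {z}. A z l * (u z - u l)) = 0"
      using laplacian_sum[OF yz(2), of A u] ker[OF yz(2)] by simp
    moreover have "\<forall>l\<in>{..<N} - {z}. 0 \<le> A z l * (u z - u l)"
      using nn yz le step.IH by auto
    ultimately have z0: "\<forall>l\<in>{..<N} - {z}. A z l * (u z - u l) = 0"
      using sum_nonneg_eq_0_iff[of "{..<N} - {z}" "\<lambda>l. A z l * (u z - u l)"] by auto
    have "y \<in> {..<N} - {z}" using yz by simp
    with z0 have "A z y * (u z - u y) = 0" by (rule bspec)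
    then show ?case using yz step.IH by simp
  qed
  then show ?thesis using le[OF i] by simp
qed

text \<open>Gershgorin's argument in the row where \<open>cmod (v i)\<close> is largest: the disc
  with centre and radius \<open>d\<close> meets the closed left half-plane in 0 only. For the
  eigenvalue 0 the spanning tree makes eigenvectors constant; so \<open>nonconst\<close> takes the
  place of \<open>v\<close> being nonzero.\<close>

lemma laplacian_eigenvalue_pos:
  fixes v :: "nat \<Rightarrow> complex"
  assumes nn: "\<forall>i<N. \<forall>j<N. A i j \<ge> 0" and tree: "has_spanning_tree N A"
    and ev: "\<And>i. i < N \<Longrightarrow> (\<Sum>l<N. complex_of_real (laplacian N A i l) * v l) = \<rho> * v i"
    and nonconst: "\<not> (\<exists>c. \<forall>i<N. v i = c)"
  shows "0 < Re \<rho>"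
proof (rule ccontr)
  assume neg: "\<not> 0 < Re \<rho>"
  have N: "0 < N" using nonconst by auto
  define m where "m = Max ((\<lambda>i. cmod (v i)) ` {..<N})"
  have le: "cmod (v j) \<le> m" if "j < N" for j unfolding m_def using that by auto
  have "m \<in> (\<lambda>i. cmod (v i)) ` {..<N}" unfolding m_def using N by (intro Max_in) auto
  then obtain i where i: "i < N" "cmod (v i) = m" by auto
  have "0 < m"
  proof (rule ccontr)
    assume "\<not> 0 < m"
    then have "\<forall>j<N. v j = 0" using le by (meson not_le norm_le_zero_iff order_trans)
    then show False using nonconst by blast
  qed
  define d where "d = (\<Sum>l\<in>{..<N} - {i}. A i l)"
  have "0 \<le> d" unfolding d_def using nn i by (intro sum_nonneg) auto
  have "\<rho> * v i = (\<Sum>l\<in>{..<N} - {i}. of_real (A i l) * (v i - v l))"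
    using laplacian_sum[OF i(1), of A v] ev[OF i(1)] by simp
  also have "\<dots> = of_real d * v i - (\<Sum>l\<in>{..<N} - {i}. of_real (A i l) * v l)"
    by (simp add: d_def sum_subtractf right_diff_distrib sum_distrib_right)
  finally have "(of_real d - \<rho>) * v i = (\<Sum>l\<in>{..<N} - {i}. of_real (A i l) * v l)"
    by (simp add: left_diff_distrib)
  then have "cmod (of_real d - \<rho>) * m = cmod (\<Sum>l\<in>{..<N} - {i}. of_real (A i l) * v l)"
    by (metis i(2) norm_mult)
  also have "\<dots> \<le> (\<Sum>l\<in>{..<N} - {i}. A i l * m)"
    using nn i le by (intro sum_norm_le) (auto simp: norm_mult intro!: mult_left_mono)
  also have "\<dots> = d * m" by (simp add: d_def sum_distrib_right)
  finally have "cmod (of_real d - \<rho>) \<le> d" using \<open>0 < m\<close> by simp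
  then have "(cmod (of_real d - \<rho>))\<^sup>2 \<le> d\<^sup>2" by (intro power_mono) auto
  then have "(d - Re \<rho>)\<^sup>2 + (Im \<rho>)\<^sup>2 \<le> d\<^sup>2" by (simp add: cmod_power2)
  then have "(Re \<rho>)\<^sup>2 + 2 * d * (- Re \<rho>) + (Im \<rho>)\<^sup>2 \<le> 0" by (simp add: power2_eq_square algebra_simps)
  moreover have "0 \<le> 2 * d * (- Re \<rho>)" using neg \<open>0 \<le> d\<close> by (intro mult_nonneg_nonneg) auto
  ultimately have "(Re \<rho>)\<^sup>2 + (Im \<rho>)\<^sup>2 \<le> 0" by linarith
  then have "\<rho> = 0" by (simp add: complex_eq_iff sum_power2_le_zero_iff)
  then have ker: "(\<Sum>l<N. complex_of_real (laplacian N A i l) * v l) = 0" if "i < N" for i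
    using ev that by simp
  obtain k where k: "k < N" "\<forall>i<N. (k, i) \<in> (edges N A)\<^sup>*"
    using tree by (auto simp: has_spanning_tree_def)
  have re: "(\<Sum>l<N. laplacian N A i l * Re (v l)) = 0" "(\<Sum>l<N. laplacian N A i l * Im (v l)) = 0"
    if "i < N" for i
    using arg_cong[OF ker[OF that], of Re] arg_cong[OF ker[OF that], of Im] by simp_all
  have "v i = v k" if "i < N" for i
  proof (rule complex_eqI)
    \<comment> \<open>The maximum principle bounds by the value at the root from above; the negated
      vectors give the bound from below.\<close>
    have "(\<Sum>l<N. laplacian N A i l * - Re (v l)) = 0" "(\<Sum>l<N. laplacian N A i l * - Im (v l)) = 0"
      if "i < N" for i
      using re[OF that] by (simp_all add: sum_negf)
    note R = laplacian_kernel_le_root[OF nn _ k(2) that]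
    show "Re (v i) = Re (v k)" "Im (v i) = Im (v k)"
      using R[of "\<lambda>l. Re (v l)", OF re(1)] R[of "\<lambda>l. Im (v l)", OF re(2)]
        R[of "\<lambda>l. - Re (v l)"] R[of "\<lambda>l. - Im (v l)"] re by (simp_all add: sum_negf)
  qed
  then show False using nonconst by blast
qed

section \<open>Jordan form of the Laplacian\<close>

locale laplacian_jordan =
  fixes N :: nat and A :: "nat \<Rightarrow> nat \<Rightarrow> real" and T Tinv :: "nat \<Rightarrow> nat \<Rightarrow> complex"
  assumes N: "N \<ge> 1" and A_nonneg: "\<forall>i<N. \<forall>j<N. A i j \<ge> 0"
    and tree: "has_spanning_tree N A"
    and T_col0: "\<forall>i<N. T i 0 = 1"
    and T_inv1: "\<forall>i<N. \<forall>j<N. (\<Sum>k<N. Tinv i k * T k j) = (if i = j then 1 else 0)"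
    and T_inv2: "\<forall>i<N. \<forall>j<N. (\<Sum>k<N. T i k * Tinv k j) = (if i = j then 1 else 0)"
    and jordan_row0: "\<forall>j<N. (\<Sum>k<N. \<Sum>l<N. Tinv 0 k * complex_of_real (laplacian N A k l) * T l j) = 0"
    and jordan_col0: "\<forall>i<N. (\<Sum>k<N. \<Sum>l<N. Tinv i k * complex_of_real (laplacian N A k l) * T l 0) = 0"
    and jordan_rest: "jordan_matrix (N - 1)
          (\<lambda>i j. \<Sum>k<N. \<Sum>l<N. Tinv (Suc i) k * complex_of_real (laplacian N A k l) * T l (Suc j))"
begin

definition conj_lap :: "nat \<Rightarrow> nat \<Rightarrow> complex" where
  "conj_lap i j = (\<Sum>k<N. \<Sum>l<N. Tinv i k * complex_of_real (laplacian N A k l) * T l j)"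

text \<open>Column 0 of \<open>T\<close> is constant, and the other rows of \<open>Tinv\<close>
  annihilate it. Hence these rows do not see a common shift of all states, and disagreement and
  state have the same coordinates there.\<close>

lemma Tinv_row_sum: assumes "Suc k < N" shows "(\<Sum>i<N. Tinv (Suc k) i) = 0"
proof -
  have "(\<Sum>i<N. Tinv (Suc k) i) = (\<Sum>i<N. Tinv (Suc k) i * T i 0)"
    using T_col0 by (intro sum.cong) auto
  then show ?thesis using T_inv1 assms by auto
qed

lemma jordan_conj_lap: "jordan_matrix (N - 1) (\<lambda>i j. conj_lap (Suc i) (Suc j))"
  using jordan_rest by (simp only: conj_lap_def)

lemma conj_lap_Suc:
  assumes "Suc i < N" "Suc j < N" "j \<noteq> i" "j \<noteq> Suc i"
  shows "conj_lap (Suc i) (Suc j) = 0"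
proof -
  have "i < N - 1" "j < N - 1" using assms by auto
  then show ?thesis using jordan_conj_lap assms unfolding jordan_matrix_def by blast
qed

lemma conj_lap_superdiag:
  assumes "Suc (Suc i) < N"
  shows "conj_lap (Suc i) (Suc (Suc i)) = 0 \<or>
    (conj_lap (Suc i) (Suc (Suc i)) = 1 \<and> conj_lap (Suc i) (Suc i) = conj_lap (Suc (Suc i)) (Suc (Suc i)))"
proof -
  have "i < N - 1" "Suc i < N - 1" using assms by auto
  then show ?thesis using jordan_conj_lap unfolding jordan_matrix_def by blast
qed

lemma Tinv_lap:
  assumes "l < N"
  shows "(\<Sum>k<N. Tinv i k * complex_of_real (laplacian N A k l)) = (\<Sum>j<N. conj_lap i j * Tinv j l)"
proof -
  have "(\<Sum>j<N. conj_lap i j * Tinv j l)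
      = (\<Sum>j<N. \<Sum>k<N. \<Sum>m<N. Tinv i k * complex_of_real (laplacian N A k m) * (T m j * Tinv j l))"
    by (simp add: conj_lap_def sum_distrib_right mult.assoc)
  also have "\<dots> = (\<Sum>k<N. \<Sum>m<N. \<Sum>j<N. Tinv i k * complex_of_real (laplacian N A k m) * (T m j * Tinv j l))"
    by (rule trans[OF sum.swap], rule sum.cong[OF refl], rule sum.swap)
  also have "\<dots> = (\<Sum>k<N. \<Sum>m<N. Tinv i k * complex_of_real (laplacian N A k m) * (if m = l then 1 else 0))"
    using T_inv2 assms by (intro sum.cong refl) (simp add: sum_distrib_left[symmetric])
  also have "\<dots> = (\<Sum>k<N. Tinv i k * complex_of_real (laplacian N A k l))"
    using assms by (simp add: mult_delta_right)
  finally show ?thesis ..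
qed

text \<open>A coordinate is driven by itself and the next one only, the triangular structure behind
  the induction. Column 0 contributes nothing by \<open>jordan_col0\<close>; the conditional covers
  the last row.\<close>

lemma Tinv_lap_Suc:
  assumes "l < N" "Suc i < N"
  shows "(\<Sum>k<N. Tinv (Suc i) k * complex_of_real (laplacian N A k l))
    = conj_lap (Suc i) (Suc i) * Tinv (Suc i) l
      + (if Suc (Suc i) < N then conj_lap (Suc i) (Suc (Suc i)) * Tinv (Suc (Suc i)) l else 0)"
proof -
  have zero: "conj_lap (Suc i) j * Tinv j l = 0" if "j < N" "j \<noteq> Suc i" "j \<noteq> Suc (Suc i)" for j
  proof (cases j)
    case 0
    then show ?thesis using jordan_col0 assms by (simp add: conj_lap_def)
  next
    case (Suc j')
    then show ?thesis using conj_lap_Suc[of i j'] that assms by simp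
  qed
  have "(\<Sum>k<N. Tinv (Suc i) k * complex_of_real (laplacian N A k l)) = (\<Sum>j<N. conj_lap (Suc i) j * Tinv j l)"
    using assms(1) by (rule Tinv_lap)
  also have "\<dots> = (\<Sum>j\<in>{Suc i, Suc (Suc i)} \<inter> {..<N}. conj_lap (Suc i) j * Tinv j l)"
    using zero by (intro sum.mono_neutral_right) auto
  also have "\<dots> = conj_lap (Suc i) (Suc i) * Tinv (Suc i) l
      + (if Suc (Suc i) < N then conj_lap (Suc i) (Suc (Suc i)) * Tinv (Suc (Suc i)) l else 0)"
    using assms by auto
  finally show ?thesis .
qed

text \<open>The column counterpart of \<open>Tinv_lap\<close>, used to read eigenvectors off the
  columns of \<open>T\<close>.\<close>

lemma lap_T:
  assumes "k < N"
  shows "(\<Sum>l<N. complex_of_real (laplacian N A k l) * T l j) = (\<Sum>i<N. T k i * conj_lap i j)"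
proof -
  have "(\<Sum>i<N. T k i * conj_lap i j)
      = (\<Sum>i<N. \<Sum>m<N. \<Sum>l<N. (T k i * Tinv i m) * (complex_of_real (laplacian N A m l) * T l j))"
    by (simp add: conj_lap_def sum_distrib_left mult.assoc)
  also have "\<dots> = (\<Sum>m<N. \<Sum>l<N. \<Sum>i<N. (T k i * Tinv i m) * (complex_of_real (laplacian N A m l) * T l j))"
    by (rule trans[OF sum.swap], rule sum.cong[OF refl], rule sum.swap)
  also have "\<dots> = (\<Sum>m<N. \<Sum>l<N. (if k = m then 1 else 0) * (complex_of_real (laplacian N A m l) * T l j))"
    using T_inv2 assms by (intro sum.cong refl) (simp add: sum_distrib_right[symmetric])
  also have "\<dots> = (\<Sum>m<N. if k = m then (\<Sum>l<N. complex_of_real (laplacian N A m l) * T l j) else 0)"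
    by (intro sum.cong refl) simp
  also have "\<dots> = (\<Sum>l<N. complex_of_real (laplacian N A k l) * T l j)"
    using assms by simp
  finally show ?thesis ..
qed

text \<open>The first column of a Jordan block gives an eigenvector, so the diagonal is traced back to the start of
  its block.\<close>

lemma conj_lap_diag_pos:
  assumes "Suc m < N"
  shows "0 < Re (conj_lap (Suc m) (Suc m))"
  using assms
proof (induction m)
  have block_start: "0 < Re (conj_lap (Suc m) (Suc m))"
    if m: "Suc m < N" and col: "\<And>i. i < N \<Longrightarrow> i \<noteq> Suc m \<Longrightarrow> conj_lap i (Suc m) = 0" for m
  proof (rule laplacian_eigenvalue_pos[OF A_nonneg tree])
    fix k assume k: "k < N"
    have "(\<Sum>l<N. complex_of_real (laplacian N A k l) * T l (Suc m)) = (\<Sum>i<N. T k i * conj_lap i (Suc m))"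
      using k by (rule lap_T)
    also have "\<dots> = (\<Sum>i\<in>{Suc m}. T k i * conj_lap i (Suc m))"
      using m col by (intro sum.mono_neutral_right) auto
    finally show "(\<Sum>l<N. complex_of_real (laplacian N A k l) * T l (Suc m))
        = conj_lap (Suc m) (Suc m) * T k (Suc m)" by simp
  next
    show "\<not> (\<exists>c. \<forall>i<N. T i (Suc m) = c)"
    proof
      assume "\<exists>c. \<forall>i<N. T i (Suc m) = c"
      then obtain c where c: "\<forall>i<N. T i (Suc m) = c" by blast
      \<comment> \<open>A constant column would be annihilated by row \<open>Suc m\<close> of
        \<open>Tinv\<close>, whereas their product is 1.\<close>
      have "(\<Sum>k<N. Tinv (Suc m) k * T k (Suc m)) = (\<Sum>k<N. Tinv (Suc m) k) * c"
        using c by (simp add: sum_distrib_right)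
      then show False using T_inv1 m Tinv_row_sum[OF m] by auto
    qed
  qed
  {
    case 0
    show ?case
    proof (rule block_start[OF 0])
      fix i assume i: "i < N" "i \<noteq> Suc 0"
      show "conj_lap i (Suc 0) = 0"
        using jordan_row0 0 conj_lap_Suc[of _ 0] i by (cases i) (auto simp: conj_lap_def)
    qed
  next
    case (Suc m)
    show ?case
    proof (cases "conj_lap (Suc m) (Suc (Suc m)) = 0")
      case True
      show ?thesis
      proof (rule block_start[OF Suc.prems])
        fix i assume i: "i < N" "i \<noteq> Suc (Suc m)"
        show "conj_lap i (Suc (Suc m)) = 0"
        proof (cases i)
          case 0
          then show ?thesis using jordan_row0 Suc.prems by (auto simp: conj_lap_def)
        next
          case (Suc i')
          then show ?thesis using True i Suc.prems conj_lap_Suc[of i' "Suc m"] by (cases "i' = m") auto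
        qed
      qed
    next
      case False
      then show ?thesis using conj_lap_superdiag[of m] Suc by auto
    qed
  }
qed

end

subsection \<open>The multi-agent system\<close>

text \<open>The set \<open>N0\<close> collects the paths violating the dynamics or the continuity of a Brownian path; all
  processes are set to \<open>0\<close> there, and extended to negative times by their value at \<open>0\<close>.\<close>

locale consensus = prob_space M + gain a \<gamma> + laplacian_jordan N A T Tinv
  for M :: "'a measure" and N :: nat and A :: "nat \<Rightarrow> nat \<Rightarrow> real"
    and \<sigma> :: "nat \<Rightarrow> nat \<Rightarrow> real" and a :: "real \<Rightarrow> real" and \<gamma> :: real
    and w :: "nat \<Rightarrow> nat \<Rightarrow> real \<Rightarrow> 'a \<Rightarrow> real"
    and x xt :: "nat \<Rightarrow> real \<Rightarrow> 'a \<Rightarrow> real" and tk :: "nat \<Rightarrow> nat \<Rightarrow> 'a \<Rightarrow> ereal"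
    and T Tinv :: "nat \<Rightarrow> nat \<Rightarrow> complex" and p :: real and N0 :: "'a set" +
  assumes bm: "\<And>j i. (j, i) \<in> edges N A \<Longrightarrow> std_brownian M (w j i)"
    and x_meas: "\<And>i t. i < N \<Longrightarrow> 0 \<le> t \<Longrightarrow> x i t \<in> borel_measurable M"
    and init_moment: "\<And>i. i < N \<Longrightarrow> (\<integral>\<^sup>+ \<omega>. ennreal (\<bar>x i 0 \<omega>\<bar> powr p) \<partial>M) < \<infinity>"
    and N0: "N0 \<in> null_sets M"
    and path: "\<And>\<omega>. \<omega> \<in> space M \<Longrightarrow> \<omega> \<notin> N0 \<Longrightarrow> protocol_path N A \<sigma> a w x xt tk \<omega>"
    and w_cont: "\<And>j i \<omega>. (j, i) \<in> edges N A \<Longrightarrow> \<omega> \<in> space M \<Longrightarrow> \<omega> \<notin> N0 \<Longrightarrow>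
        continuous_on {0..} (\<lambda>t. w j i t \<omega>)"
    and p: "p \<ge> 2"
begin

lemma AE_N0: "AE \<omega> in M. \<omega> \<notin> N0" using N0 by (rule AE_not_in)

lemma N0_sets[measurable]: "N0 \<in> sets M" using N0 by auto

section \<open>Jointly measurable versions of the noise and the states\<close>

definition wn :: "nat \<times> nat \<Rightarrow> real \<Rightarrow> 'a \<Rightarrow> real" where
  "wn e t \<omega> = (if \<omega> \<in> N0 then 0 else w (fst e) (snd e) (max 0 t) \<omega>)"

text \<open>A limit of sums rather than a definite description: \<open>lim\<close> of measurable
  functions is measurable, also where the sums diverge. \<open>V_integral\<close> identifies it with
  the Riemann-Stieltjes integral off \<open>N0\<close>.\<close>

definition V :: "nat \<times> nat \<Rightarrow> real \<Rightarrow> 'a \<Rightarrow> real" where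
  "V e t \<omega> = lim (\<lambda>n. rs_sum a (\<lambda>u. wn e u \<omega>) 0 (max 0 t) n)"

lemma finite_edges: "finite (edges N A)"
  by (rule finite_subset[of _ "{..<N} \<times> {..<N}"]) (auto simp: edges_def)

lemma wn_measurable:
  assumes "e \<in> edges N A"
  shows "(\<lambda>(t, \<omega>). wn e t \<omega>) \<in> borel_measurable (borel \<Otimes>\<^sub>M M)"
  unfolding wn_def
proof (rule borel_measurable_caratheodory)
  obtain j i where e: "e = (j, i)" by (cases e)
  show "(\<lambda>\<omega>. if \<omega> \<in> N0 then 0 else w (fst e) (snd e) t \<omega>) \<in> borel_measurable M" if "0 \<le> t" for t
  proof -
    have [measurable]: "w j i t \<in> borel_measurable M"
      using bm[of j i] assms that by (auto simp: e std_brownian_def)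
    show ?thesis unfolding e fst_conv snd_conv by measurable
  qed
  show "continuous_on {0..} (\<lambda>t. if \<omega> \<in> N0 then 0 else w (fst e) (snd e) t \<omega>)" if "\<omega> \<in> space M" for \<omega>
    using w_cont[of j i \<omega>] assms that by (cases "\<omega> \<in> N0") (auto simp: e)
qed

lemma V_measurable:
  assumes "e \<in> edges N A"
  shows "(\<lambda>(t, \<omega>). V e t \<omega>) \<in> borel_measurable (borel \<Otimes>\<^sub>M M)"
proof -
  note wn_measurable[OF assms, measurable]
  \<comment> \<open>Grid points are nonnegative, so \<open>a\<close> may be replaced by its clipped
    version, which is known to be Borel.\<close>
  have g: "grid 0 (max 0 t) n k = max 0 (grid 0 (max 0 t) n k)" for t n k
    by (simp add: grid_def)
  have "(\<lambda>(t, \<omega>). V e t \<omega>) = (\<lambda>(t, \<omega>). lim (\<lambda>n. \<Sum>k<n. a (max 0 (grid 0 (max 0 t) n (Suc k))) *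
      (wn e (grid 0 (max 0 t) n (Suc k)) \<omega> - wn e (grid 0 (max 0 t) n k) \<omega>)))"
    unfolding V_def rs_sum_def using g by simp
  also have "\<dots> \<in> borel_measurable (borel \<Otimes>\<^sub>M M)"
    unfolding grid_def by measurable
  finally show ?thesis .
qed

lemma V_measurable1: "e \<in> edges N A \<Longrightarrow> V e t \<in> borel_measurable M"
  using measurable_compose[OF measurable_Pair1'[of t borel M] V_measurable[of e]] by simp

text \<open>\<open>protocol_path\<close> asserts that the definite description is an integral; the
  grid sums converge to it, so \<open>V\<close> equals it.\<close>

lemma V_integral:
  assumes e: "(j, i) \<in> edges N A" and \<omega>: "\<omega> \<in> space M" "\<omega> \<notin> N0" and t: "0 \<le> t"
  shows "has_rs_integral a (\<lambda>s. w j i s \<omega>) 0 t (V (j, i) t \<omega>)"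
    and "V (j, i) t \<omega> = (THE I. has_rs_integral a (\<lambda>s. w j i s \<omega>) 0 t I)"
proof -
  have "i < N" using e by (auto simp: edges_def)
  then have I: "has_rs_integral a (\<lambda>s. w j i s \<omega>) 0 t (THE I. has_rs_integral a (\<lambda>s. w j i s \<omega>) 0 t I)"
    using path[OF \<omega>] e t unfolding protocol_path_def by blast
  have "rs_sum a (\<lambda>u. wn (j, i) u \<omega>) 0 (max 0 t) n = rs_sum a (\<lambda>u. w j i u \<omega>) 0 t n" for n
    using t \<omega> unfolding rs_sum_def wn_def by (intro sum.cong) (auto simp: grid_def max_def)
  then have "V (j, i) t \<omega> = lim (rs_sum a (\<lambda>u. w j i u \<omega>) 0 t)"
    by (simp add: V_def)
  also have "\<dots> = (THE I. has_rs_integral a (\<lambda>s. w j i s \<omega>) 0 t I)"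
    using rs_sum_tendsto[OF I t] by (rule limI)
  finally show "V (j, i) t \<omega> = (THE I. has_rs_integral a (\<lambda>s. w j i s \<omega>) 0 t I)" .
  with I show "has_rs_integral a (\<lambda>s. w j i s \<omega>) 0 t (V (j, i) t \<omega>)" by simp
qed

lemma V_N0: "\<omega> \<in> N0 \<Longrightarrow> V e t \<omega> = 0"
  by (simp add: V_def wn_def rs_sum_def limI)

lemma V_moment:
  obtains C where "\<And>e s t. e \<in> edges N A \<Longrightarrow> 0 \<le> s \<Longrightarrow> s \<le> t \<Longrightarrow>
    pmoment M p (\<lambda>\<omega>. \<bar>V e t \<omega> - V e s \<omega>\<bar>) \<le> ennreal (C * (1 + s) powr ((1 - 2 * \<gamma>) * (p / 2)))"
proof -
  have "0 < p" using p by simp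
  then obtain C where C: "\<And>W D s t. std_brownian M W \<Longrightarrow> 0 \<le> s \<Longrightarrow> s \<le> t \<Longrightarrow>
     (AE \<omega> in M. has_rs_integral a (\<lambda>u. W u \<omega>) s t (D \<omega>)) \<Longrightarrow>
     (\<integral>\<^sup>+\<omega>. ennreal (\<bar>D \<omega>\<bar> powr p) \<partial>M) \<le> ennreal (C * (1 + s) powr ((1 - 2 * \<gamma>) * (p / 2)))"
    using brownian_integral_moment[OF prob_space_axioms] by blast
  show thesis
  proof (rule that[of C])
    fix e s t assume e: "e \<in> edges N A" and s: "(0::real) \<le> s" "s \<le> t"
    obtain j i where ji: "e = (j, i)" by (cases e)
    have "AE \<omega> in M. has_rs_integral a (\<lambda>u. w j i u \<omega>) s t (V e t \<omega> - V e s \<omega>)"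
      using AE_N0 AE_space
    proof eventually_elim
      case (elim \<omega>)
      then show ?case
        using has_rs_integral_diff[OF V_integral(1)[of j i \<omega> s] V_integral(1)[of j i \<omega> t]] s e ji by simp
    qed
    then show "pmoment M p (\<lambda>\<omega>. \<bar>V e t \<omega> - V e s \<omega>\<bar>) \<le> ennreal (C * (1 + s) powr ((1 - 2 * \<gamma>) * (p / 2)))"
      unfolding pmoment_def using bm[of j i] e s ji by (intro C) auto
  qed
qed

definition xn :: "nat \<Rightarrow> real \<Rightarrow> 'a \<Rightarrow> real" where
  "xn i t \<omega> = (if \<omega> \<in> N0 then 0 else x i (max 0 t) \<omega>)"

definition drift :: "nat \<Rightarrow> real \<Rightarrow> 'a \<Rightarrow> real" where
  "drift i t \<omega> = a t * (\<Sum>j<N. laplacian N A i j * xt j t \<omega>)"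

definition noise :: "nat \<Rightarrow> real \<Rightarrow> 'a \<Rightarrow> real" where
  "noise i t \<omega> = (\<Sum>j\<in>{j. (j, i) \<in> edges N A}. A i j * \<sigma> j i * V (j, i) t \<omega>)"

lemma finite_in_nbrs: "finite {j. (j, i) \<in> edges N A}"
  by (rule finite_subset[of _ "{..<N}"]) (auto simp: edges_def)

lemma V_max: "V e (max 0 t) \<omega> = V e t \<omega>"
  by (simp add: V_def)

lemma drift_integrable:
  assumes "i < N" "\<omega> \<in> space M" "\<omega> \<notin> N0" "0 \<le> t"
  shows "(\<lambda>s. drift i s \<omega>) integrable_on {0..t}"
  using path[OF assms(2,3)] assms(1,4) unfolding protocol_path_def drift_def by blast

lemma state_eq:
  assumes "i < N" "\<omega> \<in> space M" "\<omega> \<notin> N0" "0 \<le> t"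
  shows "x i t \<omega> = x i 0 \<omega> - integral {0..t} (\<lambda>s. drift i s \<omega>) + noise i t \<omega>"
proof -
  have "noise i t \<omega> = (\<Sum>j\<in>{j. (j, i) \<in> edges N A}. A i j * \<sigma> j i *
                  (THE I. has_rs_integral a (\<lambda>s. w j i s \<omega>) 0 t I))"
    unfolding noise_def using assms by (intro sum.cong refl) (simp add: V_integral(2))
  then show ?thesis
    using path[OF assms(2,3)] assms(1,4) unfolding protocol_path_def drift_def by presburger
qed

text \<open>The state minus its noise part is an indefinite integral, hence continuous in time and
  jointly measurable; the noise part is covered by \<open>V_measurable\<close>.\<close>

lemma xn_measurable:
  assumes i: "i < N"
  shows "(\<lambda>(t, \<omega>). xn i t \<omega>) \<in> borel_measurable (borel \<Otimes>\<^sub>M M)"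
proof -
  define U where "U t \<omega> = (if \<omega> \<in> N0 then 0 else x i t \<omega> - noise i t \<omega>)" for t \<omega>
  have V1[measurable]: "(\<lambda>\<omega>. V (j, i) t \<omega>) \<in> borel_measurable M" if "j \<in> {j. (j, i) \<in> edges N A}" for j t
    using V_measurable1 that by simp
  have V2: "(\<lambda>(t, \<omega>). V (j, i) t \<omega>) \<in> borel_measurable (borel \<Otimes>\<^sub>M M)" if "j \<in> {j. (j, i) \<in> edges N A}" for j
    using V_measurable that by simp
  have "(\<lambda>(t, \<omega>). U (max 0 t) \<omega>) \<in> borel_measurable (borel \<Otimes>\<^sub>M M)"
  proof (rule borel_measurable_caratheodory)
    fix t :: real assume "0 \<le> t"
    then have [measurable]: "x i t \<in> borel_measurable M" using i by (rule x_meas[rotated])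
    have [measurable]: "noise i t \<in> borel_measurable M"
      unfolding noise_def by (intro borel_measurable_sum borel_measurable_times V1) auto
    show "U t \<in> borel_measurable M" unfolding U_def by measurable
  next
    fix \<omega> assume \<omega>: "\<omega> \<in> space M"
    show "continuous_on {0..} (\<lambda>t. U t \<omega>)"
    proof (cases "\<omega> \<in> N0")
      case False
      have U: "U t \<omega> = x i 0 \<omega> - integral {0..t} (\<lambda>s. drift i s \<omega>)" if "0 \<le> t" for t
        using state_eq[OF i \<omega> False that] False by (simp add: U_def)
      have "continuous (at t within {0..}) (\<lambda>t. U t \<omega>)" if t: "t \<in> {0..}" for t
      proof -
        \<comment> \<open>The interval extends to \<open>t + 1\<close> so that \<open>t\<close> is
          not its right end point.\<close>
        have "continuous_on {0..t+1} (\<lambda>t. x i 0 \<omega> - integral {0..t} (\<lambda>s. drift i s \<omega>))"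
          using drift_integrable[OF i \<omega> False, of "t+1"] t
          by (intro continuous_intros indefinite_integral_continuous_1) auto
        then have "continuous_on {0..t+1} (\<lambda>t. U t \<omega>)"
          by (subst continuous_on_cong[OF refl U]) auto
        then have "continuous (at t within {0..t+1}) (\<lambda>t. U t \<omega>)"
          using t by (simp add: continuous_on_eq_continuous_within)
        moreover have "at t within {0..t+1} = at t within {0..}"
          by (rule at_within_nhd[of _ "{..<t+1}"]) auto
        ultimately show ?thesis by simp
      qed
      then show ?thesis by (simp add: continuous_on_eq_continuous_within)
    qed (simp add: U_def)
  qed
  then have "(\<lambda>y. (case y of (t, \<omega>) \<Rightarrow> U (max 0 t) \<omega>)
        + (\<Sum>j\<in>{j. (j, i) \<in> edges N A}. A i j * \<sigma> j i * (case y of (t, \<omega>) \<Rightarrow> V (j, i) t \<omega>)))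
      \<in> borel_measurable (borel \<Otimes>\<^sub>M M)"
    using V2 by (intro borel_measurable_add borel_measurable_sum borel_measurable_times) auto
  also have "(\<lambda>y. (case y of (t, \<omega>) \<Rightarrow> U (max 0 t) \<omega>)
        + (\<Sum>j\<in>{j. (j, i) \<in> edges N A}. A i j * \<sigma> j i * (case y of (t, \<omega>) \<Rightarrow> V (j, i) t \<omega>)))
      = (\<lambda>(t, \<omega>). xn i t \<omega>)"
    by (auto simp: fun_eq_iff U_def xn_def noise_def V_max V_N0)
  finally show ?thesis .
qed

text \<open>Coordinate \<open>k\<close> uses row \<open>Suc k\<close>, since row 0 gives the
  consensus value. The value 0 past the last row lets every coordinate refer to its successor and
  starts the induction.\<close>

definition zc :: "nat \<Rightarrow> real \<Rightarrow> 'a \<Rightarrow> complex" where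
  "zc k t \<omega> = (if Suc k < N then \<Sum>i<N. Tinv (Suc k) i * of_real (xn i t \<omega>) else 0)"

definition coef :: "nat \<Rightarrow> nat \<times> nat \<Rightarrow> complex" where
  "coef k e = Tinv (Suc k) (snd e) * of_real (A (snd e) (fst e) * \<sigma> (fst e) (snd e))"

text \<open>Grouped by edges instead of receiving agents, because the moment bounds are per
  edge.\<close>

definition Zn :: "nat \<Rightarrow> real \<Rightarrow> 'a \<Rightarrow> complex" where
  "Zn k t \<omega> = (\<Sum>e\<in>edges N A. coef k e * of_real (V e t \<omega>))"

lemma Zn_noise: "Zn k t \<omega> = (\<Sum>i<N. Tinv (Suc k) i * of_real (noise i t \<omega>))"
proof -
  have "(\<Sum>i<N. Tinv (Suc k) i * of_real (noise i t \<omega>))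
      = (\<Sum>i<N. \<Sum>j\<in>{j. (j, i) \<in> edges N A}. coef k (j, i) * of_real (V (j, i) t \<omega>))"
    unfolding noise_def by (simp add: sum_distrib_left coef_def mult.assoc)
  also have "\<dots> = (\<Sum>(i, j)\<in>Sigma {..<N} (\<lambda>i. {j. (j, i) \<in> edges N A}). coef k (j, i) * of_real (V (j, i) t \<omega>))"
    using finite_in_nbrs by (intro sum.Sigma) auto
  also have "\<dots> = Zn k t \<omega>"
    unfolding Zn_def
    by (intro sum.reindex_bij_witness[of _ prod.swap prod.swap]) (auto simp: edges_def)
  finally show ?thesis ..
qed

lemma zc_measurable: "(\<lambda>(t, \<omega>). zc k t \<omega>) \<in> borel_measurable (borel \<Otimes>\<^sub>M M)"
proof -
  have "(\<lambda>y. if Suc k < N then \<Sum>i<N. Tinv (Suc k) i * of_real (case y of (t, \<omega>) \<Rightarrow> xn i t \<omega>) else 0)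
      \<in> borel_measurable (borel \<Otimes>\<^sub>M M)"
    using xn_measurable
    by (cases "Suc k < N") (auto intro!: borel_measurable_sum borel_measurable_times borel_measurable_of_real)
  also have "(\<lambda>y. if Suc k < N then \<Sum>i<N. Tinv (Suc k) i * of_real (case y of (t, \<omega>) \<Rightarrow> xn i t \<omega>) else 0)
      = (\<lambda>(t, \<omega>). zc k t \<omega>)"
    by (auto simp: zc_def fun_eq_iff)
  finally show ?thesis .
qed

lemma Zn_measurable: "(\<lambda>(t, \<omega>). Zn k t \<omega>) \<in> borel_measurable (borel \<Otimes>\<^sub>M M)"
proof -
  have "(\<lambda>y. \<Sum>e\<in>edges N A. coef k e * of_real (case y of (t, \<omega>) \<Rightarrow> V e t \<omega>))
      \<in> borel_measurable (borel \<Otimes>\<^sub>M M)"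
    using V_measurable by (intro borel_measurable_sum borel_measurable_times borel_measurable_of_real) auto
  then show ?thesis by (simp add: Zn_def case_prod_beta)
qed

lemma section_measurable:
  assumes "(\<lambda>(t, \<omega>). f t \<omega>) \<in> borel_measurable (borel \<Otimes>\<^sub>M M)"
  shows "f t \<in> borel_measurable M" "\<omega> \<in> space M \<Longrightarrow> (\<lambda>t. f t \<omega>) \<in> borel_measurable borel"
  using measurable_compose[OF measurable_Pair1'[of t borel M] assms]
    measurable_compose[OF measurable_Pair2'[of \<omega> M borel] assms] by simp_all

definition superdiag :: "nat \<Rightarrow> complex" where
  "superdiag k = (if Suc (Suc k) < N then conj_lap (Suc k) (Suc (Suc k)) else 0)"

definition row_norm :: "nat \<Rightarrow> real" where
  "row_norm k = (\<Sum>i<N. cmod (Tinv (Suc k) i))"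

lemma row_norm_nonneg: "0 \<le> row_norm k"
  unfolding row_norm_def by (intro sum_nonneg) auto

text \<open>The deviation \<open>h\<close> of \<open>variation_of_constants\<close>:
  \<open>row_norm\<close> turns the error bound \<open>sqrt a\<close> of each agent into bounds for
  the coordinates \<open>k\<close> and \<open>Suc k\<close>, and the last term is the coupling.
  Clipping \<open>s\<close> keeps it nonnegative on the whole line.\<close>

definition rem_bound :: "nat \<Rightarrow> real \<Rightarrow> 'a \<Rightarrow> real" where
  "rem_bound k s \<omega> = (cmod (conj_lap (Suc k) (Suc k)) * row_norm k + cmod (superdiag k) * row_norm (Suc k))
      * sqrt (a (max 0 s)) + cmod (superdiag k) * cmod (zc (Suc k) s \<omega>)"

lemma zc_bound:
  assumes k: "Suc k < N" and \<omega>: "\<omega> \<in> space M" "\<omega> \<notin> N0" and t: "0 \<le> t"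
  defines "\<rho> \<equiv> conj_lap (Suc k) (Suc k)"
  shows "ennreal (cmod (zc k t \<omega>)) \<le> ennreal (exp (- Re \<rho> * S t) * (cmod (zc k 0 \<omega>) + cmod (Zn k t \<omega>)))
    + (\<integral>\<^sup>+s. ennreal (kernel (Re \<rho>) t s) * ennreal (cmod \<rho> * cmod (Zn k t \<omega> - Zn k s \<omega>) + rem_bound k s \<omega>) \<partial>lborel)"
proof -
  define zt where "zt k s = (\<Sum>i<N. Tinv (Suc k) i * of_real (xt i s \<omega>))" for k s
  define g where "g s = (\<Sum>i<N. Tinv (Suc k) i * of_real (drift i s \<omega>))" for s
  note P = path[OF \<omega>, unfolded protocol_path_def]
  have step: "tk i (Suc m) \<omega> = Inf (ereal ` {t. ereal t > tk i m \<omega> \<and>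
      (x i (real_of_ereal (tk i m \<omega>)) \<omega> - x i t \<omega>)\<^sup>2 \<ge> a t})" if "i < N" for i m
    using P that by blast
  have cover: "\<exists>m. tk i m \<omega> \<le> ereal t \<and> ereal t < tk i (Suc m) \<omega>" if "i < N" "0 \<le> t" for i t
    using P that by blast
  have hold: "xt i t \<omega> = x i (real_of_ereal (tk i m \<omega>)) \<omega>"
    if "i < N" "tk i m \<omega> \<le> ereal t" "ereal t < tk i (Suc m) \<omega>" for i m t
    using P that by blast
  have xn: "xn i s \<omega> = x i s \<omega>" if "0 \<le> s" for i s
    using that \<omega> by (simp add: xn_def)
  have g_eq: "g s = a s * (\<rho> * zt k s + superdiag k * zt (Suc k) s)" for s
  proof -
    have "g s = a s * (\<Sum>i<N. \<Sum>l<N. Tinv (Suc k) i * of_real (laplacian N A i l) * of_real (xt l s \<omega>))"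
      unfolding g_def drift_def by (simp add: sum_distrib_left ac_simps)
    also have "(\<Sum>i<N. \<Sum>l<N. Tinv (Suc k) i * of_real (laplacian N A i l) * of_real (xt l s \<omega>))
        = (\<Sum>l<N. (\<Sum>i<N. Tinv (Suc k) i * of_real (laplacian N A i l)) * of_real (xt l s \<omega>))"
      by (rule trans[OF sum.swap]) (simp add: sum_distrib_right)
    also have "\<dots> = (\<Sum>l<N. \<rho> * (Tinv (Suc k) l * of_real (xt l s \<omega>))
        + superdiag k * (Tinv (Suc (Suc k)) l * of_real (xt l s \<omega>)))"
      using Tinv_lap_Suc[OF _ k] by (intro sum.cong refl) (simp add: \<rho>_def superdiag_def algebra_simps)
    also have "\<dots> = \<rho> * zt k s + superdiag k * zt (Suc k) s"
      by (simp add: zt_def sum.distrib sum_distrib_left)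
    finally show ?thesis .
  qed
  \<comment> \<open>Written with the sum, which agrees with \<open>zc\<close> only while the row
    index is below \<open>N\<close>.\<close>
  have err: "cmod (zt k s - (\<Sum>i<N. Tinv (Suc k) i * of_real (xn i s \<omega>))) \<le> row_norm k * sqrt (a s)"
    if s: "0 \<le> s" for k s
  proof -
    have "zt k s - (\<Sum>i<N. Tinv (Suc k) i * of_real (xn i s \<omega>))
        = (\<Sum>i<N. Tinv (Suc k) i * of_real (xt i s \<omega> - x i s \<omega>))"
      by (simp add: zt_def xn[OF s] sum_subtractf right_diff_distrib)
    also have "cmod \<dots> \<le> (\<Sum>i<N. cmod (Tinv (Suc k) i) * sqrt (a s))"
    proof (rule sum_norm_le)
      fix i assume "i \<in> {..<N}"
      then have i: "i < N" by simp
      have "\<bar>xt i s \<omega> - x i s \<omega>\<bar> \<le> sqrt (a s)"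
        by (rule trigger_error[of "\<lambda>m. tk i m \<omega>" "\<lambda>t. x i t \<omega>" "\<lambda>t. xt i t \<omega>",
              OF step[OF i] cover[OF i] hold[OF i] s])
      then show "cmod (Tinv (Suc k) i * of_real (xt i s \<omega> - x i s \<omega>)) \<le> cmod (Tinv (Suc k) i) * sqrt (a s)"
        unfolding norm_mult norm_of_real by (intro mult_left_mono) auto
    qed
    finally show ?thesis by (simp add: row_norm_def sum_distrib_right)
  qed
  have "\<exists>X. finite X \<and> (\<forall>s\<in>{0<..<t} - X. isCont (\<lambda>s. xt i s \<omega>) s)" if i: "i < N" for i
  proof -
    obtain X where "finite X" "\<And>s. s \<in> {0<..<t} - X \<Longrightarrow> isCont (\<lambda>s. xt i s \<omega>) s"
      using trigger_isCont[of "\<lambda>m. tk i m \<omega>" "\<lambda>t. x i t \<omega>" "\<lambda>t. xt i t \<omega>" t,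
          OF step[OF i] cover[OF i] hold[OF i]] by metis
    then show ?thesis by blast
  qed
  then obtain X where X: "\<And>i. i < N \<Longrightarrow> finite (X i)"
    "\<And>i s. i < N \<Longrightarrow> s \<in> {0<..<t} - X i \<Longrightarrow> isCont (\<lambda>s. xt i s \<omega>) s" by metis
  obtain X' where X': "finite X'" "\<And>s. s \<in> {0<..<t} - X' \<Longrightarrow> isCont a s"
    using isCont_gain by blast
  have g_int: "((\<lambda>s. g s) has_integral (\<Sum>i<N. Tinv (Suc k) i * of_real (integral {0..u} (\<lambda>s. drift i s \<omega>)))) {0..u}"
    if "0 \<le> u" for u
    unfolding g_def using drift_integrable[OF _ \<omega> that]
    by (intro has_integral_sum has_integral_mult_right has_integral_of_real) auto
  show ?thesis
  proof (rule variation_of_constants[where g = g and X = "X' \<union> (\<Union>i<N. X i)" and z = "\<lambda>s. zc k s \<omega>"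
        and Z = "\<lambda>s. Zn k s \<omega>" and h = "\<lambda>s. rem_bound k s \<omega>" and \<rho> = \<rho> and t = t])
    show "0 < Re \<rho>" unfolding \<rho>_def using k by (rule conj_lap_diag_pos)
    fix s assume s: "s \<in> {0..t}"
    then have s0: "0 \<le> s" by simp
    have "zc k s \<omega> = (\<Sum>i<N. Tinv (Suc k) i * of_real (x i 0 \<omega> - integral {0..s} (\<lambda>s. drift i s \<omega>) + noise i s \<omega>))"
      unfolding zc_def using k state_eq[OF _ \<omega> s0] by (simp add: xn[OF s0])
    also have "\<dots> = zc k 0 \<omega> - integral {0..s} g + Zn k s \<omega>"
      unfolding integral_unique[OF g_int[OF s0]] Zn_noise zc_def using k
      by (simp add: xn sum.distrib sum_subtractf algebra_simps)
    finally show "zc k s \<omega> = zc k 0 \<omega> - integral {0..s} g + Zn k s \<omega>" .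
    have "cmod (a s * \<rho> * zc k s \<omega> - g s) = a s * cmod (\<rho> * (zt k s - zc k s \<omega>) + superdiag k * zt (Suc k) s)"
    proof -
      have "a s * \<rho> * zc k s \<omega> - g s = - (a s * (\<rho> * (zt k s - zc k s \<omega>) + superdiag k * zt (Suc k) s))"
        unfolding g_eq by (simp add: algebra_simps)
      then show ?thesis using nonneg[OF s0] by (simp add: norm_mult)
    qed
    also have "\<dots> \<le> a s * rem_bound k s \<omega>"
    proof (rule mult_left_mono)
      have e1: "cmod (zt k s - zc k s \<omega>) \<le> row_norm k * sqrt (a s)"
        using err[OF s0, of k] k by (simp add: zc_def)
      have e2: "cmod (superdiag k * zt (Suc k) s)
          \<le> cmod (superdiag k) * (cmod (zc (Suc k) s \<omega>) + row_norm (Suc k) * sqrt (a s))"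
      proof (cases "Suc (Suc k) < N")
        \<comment> \<open>Past the last row \<open>superdiag k\<close> is 0, so only this case has
          content.\<close>
        case True
        have "cmod (zt (Suc k) s) \<le> cmod (zc (Suc k) s \<omega>) + cmod (zt (Suc k) s - zc (Suc k) s \<omega>)"
          using norm_triangle_sub by blast
        also have "\<dots> \<le> cmod (zc (Suc k) s \<omega>) + row_norm (Suc k) * sqrt (a s)"
          using err[OF s0, of "Suc k"] True by (simp add: zc_def)
        finally show ?thesis unfolding norm_mult by (intro mult_left_mono) auto
      qed (simp add: superdiag_def)
      have "cmod (\<rho> * (zt k s - zc k s \<omega>) + superdiag k * zt (Suc k) s)
          \<le> cmod \<rho> * (row_norm k * sqrt (a s))
            + cmod (superdiag k) * (cmod (zc (Suc k) s \<omega>) + row_norm (Suc k) * sqrt (a s))"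
        using e1 e2 by (intro norm_triangle_le add_mono) (auto simp: norm_mult intro: mult_left_mono)
      also have "\<dots> = rem_bound k s \<omega>"
        unfolding rem_bound_def \<rho>_def using s0 by (simp add: algebra_simps)
      finally show "cmod (\<rho> * (zt k s - zc k s \<omega>) + superdiag k * zt (Suc k) s) \<le> rem_bound k s \<omega>" .
    qed (rule nonneg[OF s0])
    finally show "cmod (a s * \<rho> * zc k s \<omega> - g s) \<le> a s * rem_bound k s \<omega>" .
  next
    fix s assume s: "s \<in> {0<..<t} - (X' \<union> (\<Union>i<N. X i))"
    show "isCont g s"
      unfolding g_def drift_def using s X X' by (intro continuous_intros) auto
  next
    show "g integrable_on {0..t}" using g_int[OF t] by blast
  next
    show "0 \<le> rem_bound k s \<omega>" for s
      unfolding rem_bound_def using row_norm_nonneg nonneg[of "max 0 s"] by simp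
  next
    show "(\<lambda>s. rem_bound k s \<omega>) \<in> borel_measurable borel"
      unfolding rem_bound_def
      using section_measurable(2)[OF zc_measurable \<omega>(1), of "Suc k", measurable] by measurable
  next
    show "(\<lambda>s. Zn k s \<omega>) \<in> borel_measurable borel"
      using section_measurable(2)[OF Zn_measurable \<omega>(1)] .
  qed (use X X' t in auto)
qed

lemma V_0: "V e 0 \<omega> = 0"
  by (simp add: V_def rs_sum_def grid_def limI)

lemma pmoment_const: "pmoment M p (\<lambda>_. c) = ennreal (c powr p)"
  by (simp add: pmoment_def emeasure_space_1)

text \<open>The bound depends on the earlier time only, as \<open>moments_vanish_step\<close>
  requires; it decays because \<open>\<gamma> > 1/2\<close> makes \<open>q\<close> negative. At
  \<open>s = 0\<close> it bounds the noise itself.\<close>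

lemma Zn_moment:
  obtains DZ where "moments_vanish DZ"
    "\<And>s t. 0 \<le> s \<Longrightarrow> s \<le> t \<Longrightarrow> pmoment M p (\<lambda>\<omega>. cmod (Zn k t \<omega> - Zn k s \<omega>)) \<le> DZ s"
proof -
  obtain C where C: "\<And>e s t. e \<in> edges N A \<Longrightarrow> 0 \<le> s \<Longrightarrow> s \<le> t \<Longrightarrow>
    pmoment M p (\<lambda>\<omega>. \<bar>V e t \<omega> - V e s \<omega>\<bar>) \<le> ennreal (C * (1 + s) powr ((1 - 2 * \<gamma>) * (p / 2)))"
    using V_moment by blast
  define q where "q = (1 - 2 * \<gamma>) * (p / 2)"
  have q: "q < 0" using \<gamma> p unfolding q_def by (intro mult_neg_pos) auto
  define D where "D s = ennreal (C * (1 + s) powr q)" for s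
  have "((\<lambda>s::real. C * (1 + s) powr q) \<longlongrightarrow> 0) at_top"
    using q by real_asymp
  moreover have "C * (1 + s) powr q \<le> \<bar>C\<bar>" if "0 \<le> s" for s
  proof -
    have "(1 + s) powr q \<le> (1 + s) powr 0" using that q by (intro powr_mono) auto
    then have "\<bar>C\<bar> * (1 + s) powr q \<le> \<bar>C\<bar> * 1" using that by (intro mult_left_mono) auto
    moreover have "C * (1 + s) powr q \<le> \<bar>C\<bar> * (1 + s) powr q" by (intro mult_right_mono) auto
    ultimately show ?thesis by simp
  qed
  ultimately have D: "moments_vanish D" unfolding D_def by (rule moments_vanish_real)
  show thesis
  proof (rule that[of "\<lambda>s. ennreal (real (card (edges N A)) powr p)
      * (\<Sum>e\<in>edges N A. ennreal (cmod (coef k e) powr p) * D s)"])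
    show "moments_vanish (\<lambda>s. ennreal (real (card (edges N A)) powr p)
      * (\<Sum>e\<in>edges N A. ennreal (cmod (coef k e) powr p) * D s))"
      by (intro moments_vanish_cmult moments_vanish_sum D)
    fix s t :: real assume s: "0 \<le> s" "s \<le> t"
    have "pmoment M p (\<lambda>\<omega>. cmod (Zn k t \<omega> - Zn k s \<omega>))
        = pmoment M p (\<lambda>\<omega>. cmod (\<Sum>e\<in>edges N A. coef k e * of_real (V e t \<omega> - V e s \<omega>)))"
      by (simp add: Zn_def sum_subtractf right_diff_distrib)
    also have "\<dots> \<le> ennreal (real (card (edges N A)) powr p)
      * (\<Sum>e\<in>edges N A. ennreal (cmod (coef k e) powr p) * pmoment M p (\<lambda>\<omega>. \<bar>V e t \<omega> - V e s \<omega>\<bar>))"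
      using p V_measurable1 finite_edges
      by (intro pmoment_lincomb_le[where f = "\<lambda>e \<omega>. V e t \<omega> - V e s \<omega>"]) auto
    also have "\<dots> \<le> ennreal (real (card (edges N A)) powr p)
      * (\<Sum>e\<in>edges N A. ennreal (cmod (coef k e) powr p) * D s)"
      unfolding D_def q_def using C s by (intro mult_left_mono sum_mono) auto
    finally show "pmoment M p (\<lambda>\<omega>. cmod (Zn k t \<omega> - Zn k s \<omega>)) \<le> \<dots>" .
  qed
qed

lemma zc_initial_moment: "pmoment M p (\<lambda>\<omega>. cmod (zc k 0 \<omega>)) < \<top>"
proof (cases "Suc k < N")
  case True
  have xn0: "pmoment M p (\<lambda>\<omega>. \<bar>xn i 0 \<omega>\<bar>) < \<top>" if "i < N" for i
  proof -
    have "pmoment M p (\<lambda>\<omega>. \<bar>xn i 0 \<omega>\<bar>) \<le> pmoment M p (\<lambda>\<omega>. \<bar>x i 0 \<omega>\<bar>)"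
      using p by (intro pmoment_mono) (auto simp: xn_def)
    then show ?thesis using init_moment[OF that] by (simp add: pmoment_def)
  qed
  have "pmoment M p (\<lambda>\<omega>. cmod (zc k 0 \<omega>)) = pmoment M p (\<lambda>\<omega>. cmod (\<Sum>i<N. Tinv (Suc k) i * of_real (xn i 0 \<omega>)))"
    using True by (simp add: zc_def)
  also have "\<dots> \<le> ennreal (real (card {..<N}) powr p)
      * (\<Sum>i<N. ennreal (cmod (Tinv (Suc k) i) powr p) * pmoment M p (\<lambda>\<omega>. \<bar>xn i 0 \<omega>\<bar>))"
    using p section_measurable(1)[OF xn_measurable]
    by (intro pmoment_lincomb_le[where f = "\<lambda>i \<omega>. xn i 0 \<omega>"]) auto
  also have "\<dots> < \<top>"
    using xn0 by (auto simp: ennreal_mult_less_top)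
  finally show ?thesis .
qed (simp add: zc_def pmoment_const)

lemma rem_bound_nonneg: "0 \<le> rem_bound k s \<omega>"
  unfolding rem_bound_def using row_norm_nonneg nonneg[of "max 0 s"] by simp

lemma rem_bound_measurable: "(\<lambda>(s, \<omega>). rem_bound k s \<omega>) \<in> borel_measurable (borel \<Otimes>\<^sub>M M)"
  unfolding rem_bound_def using zc_measurable[measurable] by measurable

lemma rem_bound_moment:
  assumes IH: "moments_vanish (\<lambda>t. pmoment M p (\<lambda>\<omega>. cmod (zc (Suc k) t \<omega>)))"
  shows "moments_vanish (\<lambda>s. pmoment M p (rem_bound k s))"
proof -
  define c where "c = cmod (conj_lap (Suc k) (Suc k)) * row_norm k + cmod (superdiag k) * row_norm (Suc k)"
  have c: "0 \<le> c" unfolding c_def using row_norm_nonneg by simp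
  have "((\<lambda>s. (c * sqrt (a (max 0 s))) powr p) \<longlongrightarrow> (c * sqrt 0) powr p) at_top"
    using p c nonneg tendsto_0 by (intro tendsto_intros tendsto_powr') auto
  then have lim: "((\<lambda>s. (c * sqrt (a (max 0 s))) powr p) \<longlongrightarrow> 0) at_top" by simp
  have "(c * sqrt (a (max 0 s))) powr p \<le> (c * sqrt (a 0)) powr p" for s
    using decr[of 0 "max 0 s"] c p nonneg[of "max 0 s"]
    by (intro powr_mono2 mult_left_mono real_sqrt_le_mono) auto
  then have van: "moments_vanish (\<lambda>s. ennreal ((c * sqrt (a (max 0 s))) powr p))"
    by (rule moments_vanish_real[OF lim])
  have meas[measurable]: "zc (Suc k) s \<in> borel_measurable M" for s
    by (rule section_measurable(1)[OF zc_measurable])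
  have le: "pmoment M p (rem_bound k s) \<le> ennreal (2 powr p) * (ennreal ((c * sqrt (a (max 0 s))) powr p)
      + ennreal (cmod (superdiag k) powr p) * pmoment M p (\<lambda>\<omega>. cmod (zc (Suc k) s \<omega>)))" for s
  proof -
    have "pmoment M p (rem_bound k s)
        = pmoment M p (\<lambda>\<omega>. c * sqrt (a (max 0 s)) + cmod (superdiag k) * cmod (zc (Suc k) s \<omega>))"
      by (simp add: rem_bound_def[abs_def] c_def)
    also have "\<dots> \<le> ennreal (2 powr p) * (pmoment M p (\<lambda>_. c * sqrt (a (max 0 s)))
        + pmoment M p (\<lambda>\<omega>. cmod (superdiag k) * cmod (zc (Suc k) s \<omega>)))"
      using c nonneg[of "max 0 s"] p by (intro pmoment_add_le) auto
    also have "pmoment M p (\<lambda>\<omega>. cmod (superdiag k) * cmod (zc (Suc k) s \<omega>))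
        = ennreal (cmod (superdiag k) powr p) * pmoment M p (\<lambda>\<omega>. cmod (zc (Suc k) s \<omega>))"
      by (intro pmoment_cmult) auto
    finally show ?thesis by (simp add: pmoment_const)
  qed
  have "moments_vanish (\<lambda>s. ennreal (2 powr p) * (ennreal ((c * sqrt (a (max 0 s))) powr p)
      + ennreal (cmod (superdiag k) powr p) * pmoment M p (\<lambda>\<omega>. cmod (zc (Suc k) s \<omega>))))"
    by (intro moments_vanish_cmult moments_vanish_add van IH)
  then show ?thesis using le by (rule moments_vanish_mono)
qed

text \<open>Induction from the last row upwards, since each coordinate is driven by its
  successor.\<close>

lemma zc_vanish: "moments_vanish (\<lambda>t. pmoment M p (\<lambda>\<omega>. cmod (zc k t \<omega>)))"
proof (induction "N - k" arbitrary: k rule: less_induct)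
  case less
  show ?case
  proof (cases "Suc k < N")
    case False
    then show ?thesis using moments_vanish_zero p by (simp add: zc_def pmoment_const)
  next
    case True
    then have IH: "moments_vanish (\<lambda>t. pmoment M p (\<lambda>\<omega>. cmod (zc (Suc k) t \<omega>)))"
      by (intro less) auto
    define \<rho> where "\<rho> = conj_lap (Suc k) (Suc k)"
    obtain DZ where DZ: "moments_vanish DZ"
      "\<And>s t. 0 \<le> s \<Longrightarrow> s \<le> t \<Longrightarrow> pmoment M p (\<lambda>\<omega>. cmod (Zn k t \<omega> - Zn k s \<omega>)) \<le> DZ s"
      using Zn_moment[of k] by blast
    obtain B1 where B1: "pmoment M p (\<lambda>\<omega>. cmod (zc k 0 \<omega>)) = ennreal B1" "0 \<le> B1"
      using zc_initial_moment[of k] by (metis ennreal_cases less_irrefl)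
    obtain B2' where "\<forall>t\<ge>0. DZ t \<le> ennreal B2'" using DZ(1) by (auto simp: moments_vanish_def)
    then have "DZ 0 \<le> ennreal B2'" by simp
    then obtain B2 where B2: "DZ 0 \<le> ennreal B2" "0 \<le> B2"
      by (metis ennreal_max_0 max.cobounded1)
    have meas[measurable]: "zc k s \<in> borel_measurable M" "Zn k s \<in> borel_measurable M"
      "rem_bound k s \<in> borel_measurable M" for s
      by (rule section_measurable(1)[OF zc_measurable] section_measurable(1)[OF Zn_measurable]
          section_measurable(1)[OF rem_bound_measurable])+
    show ?thesis
    proof (rule moments_vanish_step[where \<mu> = "Re \<rho>" and b = "\<lambda>t \<omega>. cmod (zc k 0 \<omega>) + cmod (Zn k t \<omega>)"
          and F = "\<lambda>t s \<omega>. cmod \<rho> * cmod (Zn k t \<omega> - Zn k s \<omega>) + rem_bound k s \<omega>"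
          and B = "2 powr p * (B1 + B2)"
          and h = "\<lambda>s. ennreal (2 powr p) * (ennreal (cmod \<rho> powr p) * DZ s + pmoment M p (rem_bound k s))"])
      show "prob_space M" by (rule prob_space_axioms)
      show "0 < Re \<rho>" unfolding \<rho>_def using True by (rule conj_lap_diag_pos)
      show "AE \<omega> in M. ennreal (cmod (zc k t \<omega>)) \<le> ennreal (exp (- Re \<rho> * S t) * (cmod (zc k 0 \<omega>) + cmod (Zn k t \<omega>)))
          + (\<integral>\<^sup>+s. ennreal (kernel (Re \<rho>) t s) * ennreal (cmod \<rho> * cmod (Zn k t \<omega> - Zn k s \<omega>) + rem_bound k s \<omega>) \<partial>lborel)"
        if "0 \<le> t" for t
        using AE_N0 AE_space by eventually_elim (unfold \<rho>_def, rule zc_bound[OF True _ _ that])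
      show "(\<lambda>(s, \<omega>). cmod \<rho> * cmod (Zn k t \<omega> - Zn k s \<omega>) + rem_bound k s \<omega>) \<in> borel_measurable (borel \<Otimes>\<^sub>M M)" for t
        using Zn_measurable[of k, measurable] rem_bound_measurable[of k, measurable] by measurable
      show "pmoment M p (\<lambda>\<omega>. cmod (zc k 0 \<omega>) + cmod (Zn k t \<omega>)) \<le> ennreal (2 powr p * (B1 + B2))"
        if "0 \<le> t" for t
      proof -
        have "pmoment M p (\<lambda>\<omega>. cmod (zc k 0 \<omega>) + cmod (Zn k t \<omega>))
            \<le> ennreal (2 powr p) * (pmoment M p (\<lambda>\<omega>. cmod (zc k 0 \<omega>)) + pmoment M p (\<lambda>\<omega>. cmod (Zn k t \<omega>)))"
          using p by (intro pmoment_add_le) auto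
        also have "\<dots> \<le> ennreal (2 powr p) * (ennreal B1 + ennreal B2)"
        proof (intro mult_left_mono add_mono)
          have "Zn k 0 \<omega> = 0" for \<omega> by (simp add: Zn_def V_0)
          then show "pmoment M p (\<lambda>\<omega>. cmod (Zn k t \<omega>)) \<le> ennreal B2"
            using DZ(2)[of 0 t] that B2 by simp
        qed (simp_all add: B1)
        also have "\<dots> = ennreal (2 powr p * (B1 + B2))"
          using B1(2) B2(2) by (simp add: ennreal_mult ennreal_plus[symmetric] del: ennreal_plus)
        finally show ?thesis .
      qed
      show "pmoment M p (\<lambda>\<omega>. cmod \<rho> * cmod (Zn k t \<omega> - Zn k s \<omega>) + rem_bound k s \<omega>)
          \<le> ennreal (2 powr p) * (ennreal (cmod \<rho> powr p) * DZ s + pmoment M p (rem_bound k s))"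
        if "0 \<le> s" "s \<le> t" for s t
      proof -
        have "pmoment M p (\<lambda>\<omega>. cmod \<rho> * cmod (Zn k t \<omega> - Zn k s \<omega>) + rem_bound k s \<omega>)
            \<le> ennreal (2 powr p) * (pmoment M p (\<lambda>\<omega>. cmod \<rho> * cmod (Zn k t \<omega> - Zn k s \<omega>)) + pmoment M p (rem_bound k s))"
          using p rem_bound_nonneg by (intro pmoment_add_le) auto
        also have "pmoment M p (\<lambda>\<omega>. cmod \<rho> * cmod (Zn k t \<omega> - Zn k s \<omega>))
            = ennreal (cmod \<rho> powr p) * pmoment M p (\<lambda>\<omega>. cmod (Zn k t \<omega> - Zn k s \<omega>))"
          by (intro pmoment_cmult) auto
        also have "\<dots> \<le> ennreal (cmod \<rho> powr p) * DZ s"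
          using DZ(2)[OF that] by (rule mult_left_mono) simp
        finally show ?thesis by (simp add: mult_left_mono add_right_mono)
      qed
      show "moments_vanish (\<lambda>s. ennreal (2 powr p) * (ennreal (cmod \<rho> powr p) * DZ s + pmoment M p (rem_bound k s)))"
        by (intro moments_vanish_cmult moments_vanish_add DZ rem_bound_moment IH)
    qed (use p rem_bound_nonneg in auto)
  qed
qed

section \<open>From the Jordan coordinates to the two limits\<close>

lemma dominated_vanish:
  assumes c: "\<And>k. 0 \<le> c k"
    and le: "\<And>t \<omega>. 0 \<le> t \<Longrightarrow> \<omega> \<notin> N0 \<Longrightarrow> 0 \<le> f t \<omega> \<and> f t \<omega> \<le> (\<Sum>k<N-1. c k * cmod (zc k t \<omega>))"
  shows "((\<lambda>t. \<integral>\<^sup>+\<omega>. ennreal (f t \<omega> powr p) \<partial>M) \<longlongrightarrow> 0) at_top"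
proof -
  have meas[measurable]: "zc k s \<in> borel_measurable M" for k s
    by (rule section_measurable(1)[OF zc_measurable])
  have "pmoment M p (f t) \<le> ennreal (real (card {..<N-1}) powr p)
      * (\<Sum>k<N-1. ennreal (c k powr p) * pmoment M p (\<lambda>\<omega>. cmod (zc k t \<omega>)))" if t: "0 \<le> t" for t
  proof -
    have "pmoment M p (f t) \<le> pmoment M p (\<lambda>\<omega>. \<Sum>k<N-1. c k * cmod (zc k t \<omega>))"
    proof (rule pmoment_mono)
      show "AE \<omega> in M. 0 \<le> f t \<omega> \<and> f t \<omega> \<le> (\<Sum>k<N-1. c k * cmod (zc k t \<omega>))"
        using AE_N0 by eventually_elim (rule le[OF t])
    qed (use p in simp)
    also have "\<dots> \<le> ennreal (real (card {..<N-1}) powr p) * (\<Sum>k<N-1. pmoment M p (\<lambda>\<omega>. c k * cmod (zc k t \<omega>)))"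
      using c p by (intro pmoment_sum_le) auto
    also have "(\<Sum>k<N-1. pmoment M p (\<lambda>\<omega>. c k * cmod (zc k t \<omega>)))
        = (\<Sum>k<N-1. ennreal (c k powr p) * pmoment M p (\<lambda>\<omega>. cmod (zc k t \<omega>)))"
      using c by (intro sum.cong refl pmoment_cmult) auto
    finally show ?thesis .
  qed
  moreover have "moments_vanish (\<lambda>t. ennreal (real (card {..<N-1}) powr p)
      * (\<Sum>k<N-1. ennreal (c k powr p) * pmoment M p (\<lambda>\<omega>. cmod (zc k t \<omega>))))"
    by (intro moments_vanish_cmult moments_vanish_sum zc_vanish)
  ultimately have "moments_vanish (\<lambda>t. pmoment M p (f t))"
    by (rule moments_vanish_mono[rotated])
  then show ?thesis by (simp add: moments_vanish_def pmoment_def)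
qed

text \<open>The reference value \<open>m\<close> is arbitrary: a common shift drops out by
  \<open>Tinv_row_sum\<close>. The theorem takes the mean weighted by \<open>r\<close>.\<close>

lemma epsilon_vanish:
  "((\<lambda>t. \<integral>\<^sup>+ \<omega>. ennreal
            (sqrt (\<Sum>k<N - 1. (cmod (\<Sum>i<N. Tinv (Suc k) i *
                 complex_of_real (x i t \<omega> - m t \<omega>)))\<^sup>2) powr p) \<partial>M) \<longlongrightarrow> 0) at_top"
proof (rule dominated_vanish[where c = "\<lambda>_. 1"])
  fix t \<omega> assume t: "(0::real) \<le> t" "\<omega> \<notin> N0"
  have "(\<Sum>i<N. Tinv (Suc k) i * complex_of_real (x i t \<omega> - m t \<omega>)) = zc k t \<omega>" if "k < N - 1" for k
  proof -
    have k: "Suc k < N" using that by simp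
    have "(\<Sum>i<N. Tinv (Suc k) i * complex_of_real (x i t \<omega> - m t \<omega>))
        = (\<Sum>i<N. Tinv (Suc k) i * complex_of_real (x i t \<omega>)) - (\<Sum>i<N. Tinv (Suc k) i) * complex_of_real (m t \<omega>)"
      by (simp add: sum_subtractf right_diff_distrib sum_distrib_right)
    then show ?thesis using Tinv_row_sum[OF k] k t by (simp add: zc_def xn_def)
  qed
  then have "sqrt (\<Sum>k<N - 1. (cmod (\<Sum>i<N. Tinv (Suc k) i * complex_of_real (x i t \<omega> - m t \<omega>)))\<^sup>2)
      = L2_set (\<lambda>k. cmod (zc k t \<omega>)) {..<N - 1}"
    by (simp add: L2_set_def)
  also have "\<dots> \<le> (\<Sum>k<N - 1. 1 * cmod (zc k t \<omega>))"
    using L2_set_le_sum[of "{..<N - 1}" "\<lambda>k. cmod (zc k t \<omega>)"] by simp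
  finally show "0 \<le> sqrt (\<Sum>k<N - 1. (cmod (\<Sum>i<N. Tinv (Suc k) i * complex_of_real (x i t \<omega> - m t \<omega>)))\<^sup>2)
      \<and> sqrt (\<Sum>k<N - 1. (cmod (\<Sum>i<N. Tinv (Suc k) i * complex_of_real (x i t \<omega> - m t \<omega>)))\<^sup>2)
        \<le> (\<Sum>k<N - 1. 1 * cmod (zc k t \<omega>))"
    by (simp add: sum_nonneg)
qed simp

text \<open>When the states are expanded in the columns of \<open>T\<close>, the term of column 0
  cancels from a difference because that column is constant; this term is the consensus value, which
  itself need not vanish.\<close>

lemma difference_vanish:
  assumes ij: "i < N" "j < N"
  shows "((\<lambda>t. \<integral>\<^sup>+ \<omega>. ennreal (\<bar>x j t \<omega> - x i t \<omega>\<bar> powr p) \<partial>M) \<longlongrightarrow> 0) at_top"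
proof (rule dominated_vanish[where c = "\<lambda>k. cmod (T j (Suc k) - T i (Suc k))"])
  fix t \<omega> assume t: "(0::real) \<le> t" "\<omega> \<notin> N0"
  define y where "y k = (\<Sum>l<N. Tinv k l * complex_of_real (x l t \<omega>))" for k
  have inv: "(\<Sum>k<N. T n k * y k) = complex_of_real (x n t \<omega>)" if n: "n < N" for n
  proof -
    have "(\<Sum>k<N. T n k * y k) = (\<Sum>k<N. \<Sum>l<N. (T n k * Tinv k l) * complex_of_real (x l t \<omega>))"
      by (simp add: y_def sum_distrib_left mult.assoc)
    also have "\<dots> = (\<Sum>l<N. (\<Sum>k<N. T n k * Tinv k l) * complex_of_real (x l t \<omega>))"
      by (rule trans[OF sum.swap]) (simp add: sum_distrib_right)
    also have "\<dots> = (\<Sum>l<N. (if n = l then 1 else 0) * complex_of_real (x l t \<omega>))"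
      using T_inv2 n by (intro sum.cong) auto
    also have "\<dots> = complex_of_real (x n t \<omega>)"
      using n by (simp add: mult_delta_left)
    finally show ?thesis .
  qed
  have "complex_of_real (x j t \<omega> - x i t \<omega>) = (\<Sum>k<N. (T j k - T i k) * y k)"
    using inv ij by (simp add: left_diff_distrib sum_subtractf)
  also have "\<dots> = (\<Sum>k<Suc (N - 1). (T j k - T i k) * y k)"
    using N by simp
  also have "\<dots> = (\<Sum>k<N - 1. (T j (Suc k) - T i (Suc k)) * y (Suc k))"
    using T_col0 ij by (subst sum.lessThan_Suc_shift) simp
  also have "\<dots> = (\<Sum>k<N - 1. (T j (Suc k) - T i (Suc k)) * zc k t \<omega>)"
    using t by (intro sum.cong) (auto simp: zc_def xn_def y_def)
  finally have "\<bar>x j t \<omega> - x i t \<omega>\<bar> = cmod (\<Sum>k<N - 1. (T j (Suc k) - T i (Suc k)) * zc k t \<omega>)"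
    by (metis norm_of_real)
  also have "\<dots> \<le> (\<Sum>k<N - 1. cmod (T j (Suc k) - T i (Suc k)) * cmod (zc k t \<omega>))"
    by (rule sum_norm_le) (simp add: norm_mult)
  finally show "0 \<le> \<bar>x j t \<omega> - x i t \<omega>\<bar> \<and> \<bar>x j t \<omega> - x i t \<omega>\<bar>
      \<le> (\<Sum>k<N - 1. cmod (T j (Suc k) - T i (Suc k)) * cmod (zc k t \<omega>))" by simp
qed simp

end

theorem theorem1:
  fixes M :: "'a measure" and N :: nat and A :: "nat \<Rightarrow> nat \<Rightarrow> real"
    and \<sigma> :: "nat \<Rightarrow> nat \<Rightarrow> real" and a :: "real \<Rightarrow> real" and \<gamma> :: real
    and w :: "nat \<Rightarrow> nat \<Rightarrow> real \<Rightarrow> 'a \<Rightarrow> real"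
    and x xt :: "nat \<Rightarrow> real \<Rightarrow> 'a \<Rightarrow> real" and tk :: "nat \<Rightarrow> nat \<Rightarrow> 'a \<Rightarrow> ereal"
    and r :: "nat \<Rightarrow> real" and T Tinv :: "nat \<Rightarrow> nat \<Rightarrow> complex" and p :: real
  assumes M: "prob_space M"
    and N: "N \<ge> 1"
    and A_diag: "\<forall>i<N. A i i = 0" and A_nonneg: "\<forall>i<N. \<forall>j<N. A i j \<ge> 0"
    and tree: "has_spanning_tree N A"
    and r_left: "\<forall>i<N. (\<Sum>j<N. r j * laplacian N A j i) = 0" and r_sum: "(\<Sum>j<N. r j) = 1"
    and T_col0: "\<forall>i<N. T i 0 = 1"
    and T_inv1: "\<forall>i<N. \<forall>j<N. (\<Sum>k<N. Tinv i k * T k j) = (if i = j then 1 else 0)"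
    and T_inv2: "\<forall>i<N. \<forall>j<N. (\<Sum>k<N. T i k * Tinv k j) = (if i = j then 1 else 0)"
    and Tinv_row0: "\<forall>j<N. Tinv 0 j = complex_of_real (r j)"
    and jordan_row0: "\<forall>j<N. (\<Sum>k<N. \<Sum>l<N. Tinv 0 k * complex_of_real (laplacian N A k l) * T l j) = 0"
    and jordan_col0: "\<forall>i<N. (\<Sum>k<N. \<Sum>l<N. Tinv i k * complex_of_real (laplacian N A k l) * T l 0) = 0"
    and jordan_rest: "jordan_matrix (N - 1)
          (\<lambda>i j. \<Sum>k<N. \<Sum>l<N. Tinv (Suc i) k * complex_of_real (laplacian N A k l) * T l (Suc j))"
    and a_nonneg: "\<forall>t\<ge>0. a t \<ge> 0"
    and a_decr: "\<forall>s t. 0 \<le> s \<and> s \<le> t \<longrightarrow> a t \<le> a s"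
    and a_bdd: "\<exists>B. \<forall>t\<ge>0. a t \<le> B"
    and a_pc: "piecewise_continuous_nonneg a"
    and \<gamma>: "1/2 < \<gamma>" "\<gamma> < 1"
    and a_rate: "\<exists>c>0. ((\<lambda>t. t powr \<gamma> * a t) \<longlongrightarrow> c) at_top"
    and \<sigma>_pos: "\<forall>(j, i)\<in>edges N A. \<sigma> j i > 0"
    and bm: "\<forall>(j, i)\<in>edges N A. std_brownian M (w j i)"
    and indep: "noise_and_init_indep M N A w x"
    and x_meas: "\<forall>i<N. \<forall>t\<ge>0. x i t \<in> borel_measurable M"
    and init_moment: "\<forall>i<N. (\<integral>\<^sup>+ \<omega>. ennreal (\<bar>x i 0 \<omega>\<bar> powr p) \<partial>M) < \<infinity>"
    and dyn: "AE \<omega> in M. protocol_path N A \<sigma> a w x xt tk \<omega>"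
    and p: "p \<ge> 2"
  shows "((\<lambda>t. \<integral>\<^sup>+ \<omega>. ennreal
            (sqrt (\<Sum>k<N - 1. (cmod (\<Sum>i<N. Tinv (Suc k) i *
                 complex_of_real (x i t \<omega> - (\<Sum>j<N. r j * x j t \<omega>))))\<^sup>2) powr p) \<partial>M)
          \<longlongrightarrow> 0) at_top
       \<and> (\<forall>i<N. \<forall>j<N.
           ((\<lambda>t. \<integral>\<^sup>+ \<omega>. ennreal (\<bar>x j t \<omega> - x i t \<omega>\<bar> powr p) \<partial>M) \<longlongrightarrow> 0) at_top)"
proof -
  \<comment> \<open>There are finitely many edges, so one null set serves all Brownian paths; joined
    with the exceptional set of the dynamics it becomes \<open>N0\<close>.\<close>
  have "AE \<omega> in M. \<forall>e\<in>edges N A. continuous_on {0..} (\<lambda>t. w (fst e) (snd e) t \<omega>)"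
  proof (rule AE_finite_allI)
    show "finite (edges N A)"
      by (rule finite_subset[of _ "{..<N} \<times> {..<N}"]) (auto simp: edges_def)
    fix e assume "e \<in> edges N A"
    with bm have "std_brownian M (w (fst e) (snd e))" by auto
    then have "AE \<omega> in M. w (fst e) (snd e) 0 \<omega> = 0 \<and> continuous_on {0..} (\<lambda>t. w (fst e) (snd e) t \<omega>)"
      unfolding std_brownian_def by blast
    then show "AE \<omega> in M. continuous_on {0..} (\<lambda>t. w (fst e) (snd e) t \<omega>)"
      by eventually_elim blast
  qed
  with dyn have "AE \<omega> in M. protocol_path N A \<sigma> a w x xt tk \<omega> \<and>
      (\<forall>e\<in>edges N A. continuous_on {0..} (\<lambda>t. w (fst e) (snd e) t \<omega>))"
    by eventually_elim blast
  then obtain N0 where N0: "\<And>\<omega>. \<omega> \<in> space M - N0 \<Longrightarrow> protocol_path N A \<sigma> a w x xt tk \<omega> \<and>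
      (\<forall>e\<in>edges N A. continuous_on {0..} (\<lambda>t. w (fst e) (snd e) t \<omega>))" "N0 \<in> null_sets M"
    by (rule AE_E3) blast
  interpret prob_space M by (rule M)
  interpret gain a \<gamma>
    by unfold_locales (use a_nonneg a_decr a_pc \<gamma> a_rate in blast)+
  interpret laplacian_jordan N A T Tinv
    by unfold_locales (fact N A_nonneg tree T_col0 T_inv1 T_inv2 jordan_row0 jordan_col0 jordan_rest)+
  interpret consensus M N A \<sigma> a \<gamma> w x xt tk T Tinv p N0
  proof unfold_locales
    fix j i assume e: "(j, i) \<in> edges N A"
    then show "std_brownian M (w j i)" using bm by auto
    fix \<omega> assume "\<omega> \<in> space M" "\<omega> \<notin> N0"
    then show "continuous_on {0..} (\<lambda>t. w j i t \<omega>)" using N0(1)[of \<omega>] e by auto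
  qed (use x_meas init_moment N0 p in auto)
  show ?thesis
    using epsilon_vanish[of "\<lambda>t \<omega>. \<Sum>j<N. r j * x j t \<omega>"] difference_vanish by blast
qed

end
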